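(* Let $M=p_1^{n_1}M_1$, where $p_1$ is prime, $n_1\in\mathbb{N}$, $M_1\in\mathbb{N}$ and $p_1\nmid M_1$. Assume that for every $M'\mid M_1$ and every tiling $A'\oplus B'=\mathbb{Z}_{M'}$, both $A'$ and $B'$ satisfy (T2). Assume further that $$p_1>D(M_1),\qquad\text{where } D(N):=\frac{N}{\prod_{p\mid N,\ p\text{ prime}}p}.$$ Then for every tiling $A\oplus B=\mathbb{Z}_M$, both $A$ and $B$ satisfy (T2).
   Context: For $N\in\mathbb{N}$ and $A,B\subset\mathbb{Z}_N$, write $A\oplus B=\mathbb{Z}_N$ (a tiling) if every element of $\mathbb{Z}_N$ has a unique representation $a+b$ with $a\in A$, $b\in B$. A subset $A\subset\mathbb{Z}_N$ is identified with a subset of $\{0,1,\dots,N-1\}$, and its mask polynomial is $A(X)=\sum_{a\in A}X^a$. $\Phi_s$ denotes the $s$-th cyclotomic polynomial. Let $S_A$ be the set of prime powers $p^\alpha$ ($\alpha\ge1$) such that $\Phi_{p^\alpha}(X)\mid A(X)$. The set $A$ satisfies (T2) if: whenever $s_1,\dots,s_k\in S_A$ are powers of distinct primes, $\Phi_{s_1s_2\cdots s_k}(X)$ divides $A(X)$. *)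

theory Defs
  imports "HOL-Analysis.Analysis" "HOL-Computational_Algebra.Computational_Algebra"
begin

definition cyclotomic :: "nat \<Rightarrow> complex poly" where
  "cyclotomic n = (\<Prod>k\<in>{k. k < n \<and> coprime k n}. [:- cis (2 * pi * real k / real n), 1:])"

definition mask :: "nat set \<Rightarrow> complex poly" where
  "mask A = (\<Sum>a\<in>A. monom 1 a)"

definition tiling :: "nat \<Rightarrow> nat set \<Rightarrow> nat set \<Rightarrow> bool" where
  "tiling N A B \<longleftrightarrow> A \<subseteq> {..<N} \<and> B \<subseteq> {..<N} \<and>
     (\<forall>x<N. \<exists>!ab. fst ab \<in> A \<and> snd ab \<in> B \<and> (fst ab + snd ab) mod N = x)"

definition SA :: "nat set \<Rightarrow> nat set" where
  "SA A = {s. \<exists>p \<alpha>. prime p \<and> \<alpha> \<ge> 1 \<and> s = p ^ \<alpha> \<and> cyclotomic s dvd mask A}"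

definition T2 :: "nat set \<Rightarrow> bool" where
  "T2 A \<longleftrightarrow> (\<forall>S. finite S \<and> S \<noteq> {} \<and> S \<subseteq> SA A \<and>
      (\<forall>s\<in>S. \<forall>t\<in>S. \<forall>p q. prime p \<and> prime q \<and> p dvd s \<and> q dvd t \<and> s \<noteq> t \<longrightarrow> p \<noteq> q)
      \<longrightarrow> cyclotomic (\<Prod>S) dvd mask A)"

definition D :: "nat \<Rightarrow> nat" where
  "D N = N div (\<Prod>p\<in>prime_factors N. p)"

end

theory Submission
  imports Defs "HOL-Number_Theory.Cong"
begin

text \<open>
  Masks are evaluated at roots of unity, so that identities modulo \<open>X ^ N - 1\<close> become identities
  between complex numbers, and (T2) for divisors of \<open>N\<close> becomes vanishing at primitive roots.
  If \<open>r\<close> is coprime to \<open>|A|\<close>, then \<open>A\<close> may be replaced by \<open>rA\<close> in a tiling (Tijdeman). Hence a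
  prime dividing \<open>N\<close> but not \<open>|A|\<close> or not \<open>|B|\<close> can be divided out of the modulus, and otherwise
  every prime divides \<open>N\<close> at least twice.

  Let \<open>M = p ^ n * L\<close> with \<open>n > 0\<close>. Dilating \<open>A\<close> by a suitable unit that is 1 modulo \<open>L\<close> shows that
  two representations whose sums agree modulo \<open>M / p\<close> have the same \<open>A\<close>-component or the same
  \<open>B\<close>-component modulo \<open>p ^ n\<close>. Therefore each class modulo \<open>M / p\<close> freezes the residue of one of
  the two components. If both kinds of classes occur, counting arguments in \<open>\<int>/L\<close> (exact ones, or
  modulo \<open>p\<close>, where \<open>X ^ L - 1\<close> is squarefree) force \<open>p ^ 2 \<le> L\<close>. After the reduction \<open>L\<close> is
  powerful, so \<open>L \<le> D L ^ 2 \<le> D M1 ^ 2 < p ^ 2\<close>; hence only one kind occurs, and one of the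
  tiles can be thinned out by a factor \<open>p\<close> to give a tiling modulo \<open>M / p\<close>.
\<close>


subsection \<open>Primitive roots of unity and Fourier inversion\<close>

text \<open>Exact multiplicative order; \<open>0 < s\<close> excludes elements of infinite order,
  for which \<open>z ^ k = 1\<close> holds only at \<open>k = 0\<close>.\<close>

definition primroot :: "nat \<Rightarrow> complex \<Rightarrow> bool" where
  "primroot s z \<longleftrightarrow> 0 < s \<and> (\<forall>k. z ^ k = 1 \<longleftrightarrow> s dvd k)"

lemma primroot_cis:
  assumes "0 < s" "coprime k s"
  shows "primroot s (cis (2 * pi * real k / real s))"
proof -
  have "cis (2 * pi * real k / real s) ^ j = 1 \<longleftrightarrow> s dvd j" for j
  proof -
    have "cis (2 * pi * real k / real s) ^ j
        = exp (2 * of_real pi * \<i> * of_nat (k * j) / of_nat s)"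
      by (simp add: cis_conv_exp exp_of_nat_mult [symmetric] field_simps)
    then show ?thesis
      using complex_root_unity_eq_1[of s "k * j"] assms
      by (simp add: coprime_commute coprime_dvd_mult_right_iff)
  qed
  then show ?thesis using assms by (simp add: primroot_def)
qed

lemma primroot_exists: "0 < s \<Longrightarrow> \<exists>z. primroot s z"
  using primroot_cis[of s 1] by auto

lemma primroot_power_eq_iff:
  assumes "primroot s z"
  shows "z ^ i = z ^ j \<longleftrightarrow> [i = j] (mod s)"
proof -
  have z: "z \<noteq> 0"
    using assms by (auto simp: primroot_def power_0_left dest!: spec[of _ s])
  have *: "z ^ i = z ^ j \<longleftrightarrow> [i = j] (mod s)" if "i \<le> j" for i j
  proof -
    have "z ^ j = z ^ i * z ^ (j - i)" using that by (simp flip: power_add)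
    then have "z ^ i = z ^ j \<longleftrightarrow> s dvd j - i"
      using assms z by (simp add: primroot_def)
    then show ?thesis
      using that by (simp add: cong_sym_eq[of i] cong_altdef_nat)
  qed
  show ?thesis using *[of i j] *[of j i] by (cases "i \<le> j") (auto simp: cong_sym_eq)
qed

text \<open>The powers \<open>z ^ r\<close> with \<open>r < s\<close> are \<open>s\<close> distinct
  roots of \<open>X ^ s - 1\<close>, hence all of them.\<close>

lemma root_of_unity_power_primroot:
  assumes "primroot s z" "w ^ s = 1"
  shows "\<exists>r<s. w = z ^ r"
proof -
  have s: "0 < s" using assms by (simp add: primroot_def)
  have sub: "(\<lambda>r. z ^ r) ` {..<s} \<subseteq> {w. w ^ s = 1}"
    using assms by (auto simp: primroot_def power_mult[symmetric])
  have "inj_on (\<lambda>r. z ^ r) {..<s}"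
    using assms by (auto simp: inj_on_def primroot_power_eq_iff cong_less_modulus_unique_nat)
  then have "card ((\<lambda>r. z ^ r) ` {..<s}) = card {w::complex. w ^ s = 1}"
    using s by (simp add: card_image card_roots_unity_eq)
  then have "(\<lambda>r. z ^ r) ` {..<s} = {w. w ^ s = 1}"
    using s sub by (intro card_subset_eq finite_roots_unity) auto
  then show ?thesis using assms(2) by blast
qed

lemma primroot_power:
  assumes "primroot s z"
  shows "primroot s (z ^ r) \<longleftrightarrow> coprime r s"
proof
  assume "coprime r s"
  then show "primroot s (z ^ r)"
    using assms by (simp add: primroot_def power_mult[symmetric] coprime_commute coprime_dvd_mult_right_iff)
next
  assume pr: "primroot s (z ^ r)"
  \<comment> \<open>With \<open>d = gcd r s\<close>, already the exponent \<open>s div d\<close>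
    sends \<open>z ^ r\<close> to 1, so order \<open>s\<close> forces \<open>d = 1\<close>.\<close>
  obtain d where d: "d = gcd r s" by simp
  have s: "0 < s" using assms by (simp add: primroot_def)
  have "s dvd r * (s div d)"
    using d by (metis div_mult_swap dvd_mult_right dvd_triv_right gcd_dvd1 gcd_dvd2 dvd_div_mult dvd_mult_div_cancel mult.commute)
  then have "(z ^ r) ^ (s div d) = 1"
    using assms by (simp add: primroot_def power_mult[symmetric])
  then have "s dvd s div d" using pr by (simp add: primroot_def)
  then have "d = 1" using s d
    by (metis dvd_imp_le div_le_dividend dvd_div_eq_0_iff div_eq_dividend_iff gcd_dvd2 le_antisym not_gr0)
  then show "coprime r s" using d by (simp add: coprime_iff_gcd_eq_1)
qed

lemma primroot_conjugate:
  assumes "primroot s z" "primroot s w"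
  shows "\<exists>r. coprime r s \<and> w = z ^ r"
proof -
  have "w ^ s = 1" using assms(2) by (simp add: primroot_def)
  then show ?thesis
    using root_of_unity_power_primroot[OF assms(1)] primroot_power[OF assms(1)] assms(2) by blast
qed

lemma primroot_order_exists:
  assumes "z ^ N = 1" "0 < N"
  shows "\<exists>d. d dvd N \<and> primroot d z"
proof -
  define d where "d = (LEAST d. 0 < d \<and> z ^ d = 1)"
  have d: "0 < d" "z ^ d = 1"
    using LeastI[of "\<lambda>d. 0 < d \<and> z ^ d = 1" N] assms by (auto simp: d_def)
  have least: "\<not> (0 < e \<and> z ^ e = 1)" if "e < d" for e
    using not_less_Least that unfolding d_def by blast
  have "z ^ k = 1 \<longleftrightarrow> d dvd k" for k
  proof -
    have "z ^ k = (z ^ d) ^ (k div d) * z ^ (k mod d)"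
      by (simp flip: power_mult power_add)
    then have "z ^ k = z ^ (k mod d)" by (simp add: d)
    then show ?thesis
      using least[of "k mod d"] d by (auto simp: dvd_eq_mod_eq_0)
  qed
  then show ?thesis using d assms by (intro exI[of _ d]) (auto simp: primroot_def)
qed

lemma sum_roots_unity_power:
  assumes "0 < N"
  shows "(\<Sum>z | z ^ N = (1::complex). z ^ i * inverse z ^ j) = (if [i = j] (mod N) then of_nat N else 0)"
proof -
  obtain w where w: "primroot N w" using primroot_exists assms by blast
  have w0: "w \<noteq> 0" using w assms by (auto simp: primroot_def power_0_left dest!: spec[of _ N])
  have wN: "w ^ N = 1" using w by (simp add: primroot_def)
  let ?R = "{z. z ^ N = (1::complex)}"
  let ?S = "\<Sum>z\<in>?R. z ^ i * inverse z ^ j"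
  show ?thesis
  proof (cases "[i = j] (mod N)")
    case True
    have "z ^ i * inverse z ^ j = 1" if "z \<in> ?R" for z
    proof -
      have zN: "z ^ N = 1" using that by simp
      obtain d where d: "d dvd N" "primroot d z"
        using primroot_order_exists[OF zN assms] by blast
      have "z ^ i = z ^ j"
        using d True primroot_power_eq_iff[OF d(2)] cong_dvd_modulus_nat by blast
      moreover have "z \<noteq> 0" using that assms by (auto simp: power_0_left)
      ultimately show ?thesis by (simp flip: power_mult_distrib)
    qed
    then show ?thesis using True assms by (simp add: card_roots_unity_eq)
  next
    case False
    \<comment> \<open>Multiplication by a generator \<open>w\<close> permutes the roots, so the sum
      equals itself times a factor different from 1.\<close>
    have "?S = (\<Sum>z\<in>?R. (w * z) ^ i * inverse (w * z) ^ j)"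
    proof (rule sum.reindex_bij_betw[symmetric])
      show "bij_betw ((*) w) ?R ?R"
        using w0 wN by (intro bij_betwI[where g = "\<lambda>z. z / w"]) (auto simp: power_mult_distrib power_divide)
    qed
    also have "\<dots> = (w ^ i * inverse w ^ j) * ?S"
      by (simp add: sum_distrib_left power_mult_distrib mult_ac)
    finally have "?S = (w ^ i * inverse w ^ j) * ?S" .
    moreover have "w ^ i * inverse w ^ j \<noteq> 1"
      using False w0 primroot_power_eq_iff[OF w, of i j] by (auto simp: field_simps)
    ultimately show ?thesis using False by auto
  qed
qed

text \<open>Turns evaluations at roots of unity into counts. The map \<open>f\<close> on an index
  set covers plain sets as well as pairs mapped to their sum.\<close>

lemma count_Fourier_inversion:
  assumes "0 < N" "finite I"
  shows "of_nat N * of_nat (card {i\<in>I. [f i = y] (mod N)})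
       = (\<Sum>z | z ^ N = (1::complex). (\<Sum>i\<in>I. z ^ f i) * inverse z ^ y)"
proof -
  have "(\<Sum>z | z ^ N = (1::complex). (\<Sum>i\<in>I. z ^ f i) * inverse z ^ y)
      = (\<Sum>i\<in>I. \<Sum>z | z ^ N = (1::complex). z ^ f i * inverse z ^ y)"
    unfolding sum_distrib_right by (rule sum.swap)
  also have "\<dots> = (\<Sum>i\<in>I. if [f i = y] (mod N) then of_nat N else 0)"
    using assms by (simp add: sum_roots_unity_power)
  also have "\<dots> = of_nat N * of_nat (card {i\<in>I. [f i = y] (mod N)})"
    using assms by (simp add: sum.If_cases Int_def mult.commute)
  finally show ?thesis by simp
qed

section \<open>Evaluation of masks at roots of unity\<close>

definition ev :: "nat set \<Rightarrow> complex \<Rightarrow> complex" where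
  "ev A z = (\<Sum>a\<in>A. z ^ a)"

lemma ev_1 [simp]: "ev A 1 = of_nat (card A)"
  by (simp add: ev_def)

lemma ev_empty [simp]: "ev {} z = 0"
  by (simp add: ev_def)

lemma ev_mult: "ev A z * ev B z = (\<Sum>(a, b)\<in>A \<times> B. z ^ (a + b))"
  by (simp add: ev_def sum_product sum.cartesian_product power_add)

lemma power_cong_root_of_unity:
  fixes z :: complex
  assumes "z ^ N = 1" "[i = j] (mod N)"
  shows "z ^ i = z ^ j"
proof -
  have *: "z ^ k = z ^ (k mod N)" for k
  proof -
    have "z ^ k = (z ^ N) ^ (k div N) * z ^ (k mod N)"
      by (simp flip: power_mult power_add)
    then show ?thesis using assms by simp
  qed
  show ?thesis using *[of i] *[of j] assms(2) by (simp add: cong_def)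
qed

lemma ev_lessThan_root_of_unity:
  assumes "z ^ N = 1"
  shows "ev {..<N} z = (if z = 1 then of_nat N else 0)"
  using assms by (auto simp: ev_def geometric_sum)

subsection \<open>Integer polynomial functions\<close>

text \<open>Integer polynomials enter as functions because identities are used pointwise at roots of
  unity; a congruence modulo \<open>q\<close> becomes an error term
  \<open>of_nat q * h z\<close>.\<close>

definition intpoly :: "(complex \<Rightarrow> complex) \<Rightarrow> bool" where
  "intpoly f \<longleftrightarrow> (\<exists>g. (\<forall>i. coeff g i \<in> \<int>) \<and> f = poly g)"

lemma intpoly_const [intro]: "c \<in> \<int> \<Longrightarrow> intpoly (\<lambda>z. c)"
  unfolding intpoly_def by (rule exI[of _ "[:c:]"]) (auto simp: coeff_pCons split: nat.split)

lemma intpoly_monom [intro]: "intpoly (\<lambda>z. z ^ k)"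
  unfolding intpoly_def by (rule exI[of _ "monom 1 k"]) (auto simp: poly_monom)

lemma intpoly_add [intro]: "intpoly f \<Longrightarrow> intpoly g \<Longrightarrow> intpoly (\<lambda>z. f z + g z)"
  unfolding intpoly_def
proof (elim exE conjE)
  fix f' g' assume "\<forall>i. coeff f' i \<in> \<int>" "f = poly f'" "\<forall>i. coeff g' i \<in> \<int>" "g = poly g'"
  then show "\<exists>h. (\<forall>i. coeff h i \<in> \<int>) \<and> (\<lambda>z. f z + g z) = poly h"
    by (intro exI[of _ "f' + g'"]) (auto simp: fun_eq_iff)
qed

lemma intpoly_diff [intro]: "intpoly f \<Longrightarrow> intpoly g \<Longrightarrow> intpoly (\<lambda>z. f z - g z)"
  unfolding intpoly_def
proof (elim exE conjE)
  fix f' g' assume "\<forall>i. coeff f' i \<in> \<int>" "f = poly f'" "\<forall>i. coeff g' i \<in> \<int>" "g = poly g'"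
  then show "\<exists>h. (\<forall>i. coeff h i \<in> \<int>) \<and> (\<lambda>z. f z - g z) = poly h"
    by (intro exI[of _ "f' - g'"]) (auto simp: fun_eq_iff)
qed

lemma intpoly_mult [intro]: "intpoly f \<Longrightarrow> intpoly g \<Longrightarrow> intpoly (\<lambda>z. f z * g z)"
  unfolding intpoly_def
proof (elim exE conjE)
  fix f' g' assume "\<forall>i. coeff f' i \<in> \<int>" "f = poly f'" "\<forall>i. coeff g' i \<in> \<int>" "g = poly g'"
  then show "\<exists>h. (\<forall>i. coeff h i \<in> \<int>) \<and> (\<lambda>z. f z * g z) = poly h"
    by (intro exI[of _ "f' * g'"]) (auto simp: fun_eq_iff coeff_mult)
qed

lemma intpoly_power [intro]: "intpoly f \<Longrightarrow> intpoly (\<lambda>z. f z ^ k)"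
  by (induction k) auto

lemma intpoly_sum [intro]: "(\<And>i. i \<in> I \<Longrightarrow> intpoly (f i)) \<Longrightarrow> intpoly (\<lambda>z. \<Sum>i\<in>I. f i z)"
  by (induction I rule: infinite_finite_induct) auto

lemma intpoly_ev [intro]: "intpoly (ev A)"
  unfolding ev_def by auto

text \<open>Reduction modulo \<open>X ^ N - 1\<close> adds up the integer coefficients with index
  congruent to \<open>y\<close>. In this way a factor \<open>q\<close> in an error term becomes
  divisibility of a count.\<close>

lemma intpoly_Fourier_coeff:
  assumes "intpoly f" "0 < N"
  shows "\<exists>k\<in>\<int>. (\<Sum>z | z ^ N = 1. f z * inverse z ^ y) = of_nat N * k"
proof -
  obtain g where g: "\<And>i. coeff g i \<in> \<int>" "f = poly g"
    using assms by (auto simp: intpoly_def)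
  have "(\<Sum>z | z ^ N = 1. f z * inverse z ^ y)
      = (\<Sum>i\<le>degree g. coeff g i * (\<Sum>z | z ^ N = 1. z ^ i * inverse z ^ y))"
    unfolding g poly_altdef sum_distrib_right sum_distrib_left
    by (subst sum.swap) (simp add: mult_ac)
  also have "\<dots> = of_nat N * (\<Sum>i\<le>degree g. if [i = y] (mod N) then coeff g i else 0)"
    using assms by (auto simp: sum_roots_unity_power sum_distrib_left intro!: sum.cong)
  finally show ?thesis using g by (intro bexI) auto
qed

lemma intpoly_add_power_prime:
  assumes "prime q" "intpoly f" "intpoly g"
  shows "\<exists>h. intpoly h \<and> (\<forall>z. (f z + g z) ^ q = f z ^ q + g z ^ q + of_nat q * h z)"
proof -
  define h where "h = (\<lambda>z. \<Sum>k\<in>{1..<q}. of_nat ((q choose k) div q) * (f z ^ k * g z ^ (q - k)))"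
  have "intpoly h" using assms unfolding h_def by (intro intpoly_sum intpoly_mult) auto
  moreover have "(f z + g z) ^ q = f z ^ q + g z ^ q + of_nat q * h z" for z
  proof -
    have q: "1 < q" using assms prime_gt_1_nat by blast
    have "{..q} = insert 0 (insert q {1..<q})" using q by auto
    then have "(f z + g z) ^ q = f z ^ q + g z ^ q
        + (\<Sum>k\<in>{1..<q}. of_nat (q choose k) * f z ^ k * g z ^ (q - k))"
      using q by (simp add: binomial_ring)
    also have "(\<Sum>k\<in>{1..<q}. of_nat (q choose k) * f z ^ k * g z ^ (q - k)) = of_nat q * h z"
      unfolding h_def sum_distrib_left
    proof (rule sum.cong)
      fix k assume k: "k \<in> {1..<q}"
      then have "q dvd q choose k" using assms by (intro dvd_choose_prime) auto
      then have "(of_nat (q choose k) :: complex) = of_nat q * of_nat ((q choose k) div q)"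
        by (metis dvd_mult_div_cancel of_nat_mult)
      then show "of_nat (q choose k) * f z ^ k * g z ^ (q - k)
          = of_nat q * (of_nat ((q choose k) div q) * (f z ^ k * g z ^ (q - k)))"
        by simp
    qed simp
    finally show ?thesis .
  qed
  ultimately show ?thesis by blast
qed

text \<open>Frobenius: modulo \<open>q\<close> the power distributes over the sum, since the inner
  binomial coefficients are divisible by \<open>q\<close>.\<close>

lemma ev_power_prime:
  assumes "prime q" "finite A"
  shows "\<exists>h. intpoly h \<and> (\<forall>z. ev A z ^ q = ev A (z ^ q) + of_nat q * h z)"
  using assms(2)
proof (induction A rule: finite_induct)
  case empty
  have "ev {} z ^ q = ev {} (z ^ q) + of_nat q * 0" for z
    using prime_gt_0_nat[OF assms(1)] by simp
  then show ?case by (intro exI[of _ "\<lambda>z. 0"]) auto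
next
  case (insert a A)
  then obtain h where h: "intpoly h" "\<And>z. ev A z ^ q = ev A (z ^ q) + of_nat q * h z" by blast
  obtain h' where h': "intpoly h'"
    "\<And>z. (z ^ a + ev A z) ^ q = (z ^ a) ^ q + ev A z ^ q + of_nat q * h' z"
    using intpoly_add_power_prime[OF assms(1) intpoly_monom[of a] intpoly_ev[of A]] by blast
  have ins: "ev (insert a A) z = z ^ a + ev A z" for z using insert by (simp add: ev_def)
  have "ev (insert a A) z ^ q = ev (insert a A) (z ^ q) + of_nat q * (h z + h' z)" for z
    unfolding ins h' h by (simp add: algebra_simps power_mult[symmetric])
  then show ?case using h h' by (intro exI[of _ "\<lambda>z. h z + h' z"]) auto
qed

subsection \<open>Tilings of cyclic groups\<close>

text \<open>Representatives may exceed \<open>N\<close>, so dilates and rescaled pieces need no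
  reduction. Distinct elements of one tile are still distinct modulo \<open>N\<close>, by the
  uniqueness clause with a common element of the other tile.\<close>

definition tiles :: "nat \<Rightarrow> nat set \<Rightarrow> nat set \<Rightarrow> bool" where
  "tiles N A B \<longleftrightarrow> 0 < N \<and> finite A \<and> finite B \<and>
    (\<forall>a\<in>A. \<forall>a'\<in>A. \<forall>b\<in>B. \<forall>b'\<in>B. [a + b = a' + b'] (mod N) \<longrightarrow> a = a' \<and> b = b') \<and>
    (\<forall>y. \<exists>a\<in>A. \<exists>b\<in>B. [a + b = y] (mod N))"

lemma tiles_sym: "tiles N A B \<Longrightarrow> tiles N B A"
  unfolding tiles_def by (metis add.commute)

lemma tiles_inj:
  "tiles N A B \<Longrightarrow> a \<in> A \<Longrightarrow> a' \<in> A \<Longrightarrow> b \<in> B \<Longrightarrow> b' \<in> B \<Longrightarrow> [a + b = a' + b'] (mod N)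
    \<Longrightarrow> a = a' \<and> b = b'"
  unfolding tiles_def by blast

lemma tiles_surj:
  assumes "tiles N A B"
  obtains a b where "a \<in> A" "b \<in> B" "[a + b = y] (mod N)"
  using assms unfolding tiles_def by blast

lemma tiles_bij_betw:
  assumes "tiles N A B"
  shows "bij_betw (\<lambda>(a, b). (a + b) mod N) (A \<times> B) {..<N}"
proof -
  have N: "0 < N" using assms by (simp add: tiles_def)
  have inj: "inj_on (\<lambda>(a, b). (a + b) mod N) (A \<times> B)"
    using tiles_inj[OF assms] by (fastforce simp: inj_on_def cong_def)
  have "y \<in> (\<lambda>(a, b). (a + b) mod N) ` (A \<times> B)" if "y < N" for y
  proof -
    obtain a b where "a \<in> A" "b \<in> B" "[a + b = y] (mod N)" using tiles_surj[OF assms] .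
    then show ?thesis using that by (auto simp: cong_def intro!: image_eqI[of _ _ "(a, b)"])
  qed
  then show ?thesis using N inj by (auto simp: bij_betw_def)
qed

lemma tiles_card: "tiles N A B \<Longrightarrow> card A * card B = N"
  using bij_betw_same_card[OF tiles_bij_betw] by (fastforce simp: card_cartesian_product)

lemma tiles_ev_eq_0:
  assumes "tiles N A B" "z ^ N = 1" "z \<noteq> 1"
  shows "ev A z = 0 \<or> ev B z = 0"
proof -
  have "ev A z * ev B z = (\<Sum>ab\<in>A \<times> B. z ^ (case ab of (a, b) \<Rightarrow> (a + b) mod N))"
    unfolding ev_mult using assms(2)
    by (intro sum.cong) (auto intro!: power_cong_root_of_unity simp: cong_def)
  also have "\<dots> = ev {..<N} z"
    unfolding ev_def by (rule sum.reindex_bij_betw[OF tiles_bij_betw[OF assms(1)]])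
  also have "\<dots> = 0" using assms by (simp add: ev_lessThan_root_of_unity)
  finally show ?thesis by simp
qed

section \<open>Dilation of a tile by a number coprime to its cardinality\<close>

lemma tilesI_surj:
  assumes "0 < N" "finite A" "finite B" "card A * card B = N"
    and surj: "\<And>y. \<exists>a\<in>A. \<exists>b\<in>B. [a + b = y] (mod N)"
  shows "tiles N A B"
proof -
  let ?f = "\<lambda>(a, b). (a + b) mod N"
  have "{..<N} \<subseteq> ?f ` (A \<times> B)"
  proof
    fix y assume "y \<in> {..<N}"
    moreover obtain a b where "a \<in> A" "b \<in> B" "[a + b = y] (mod N)" using surj by blast
    ultimately show "y \<in> ?f ` (A \<times> B)"
      by (auto simp: cong_def intro!: image_eqI[of _ _ "(a, b)"])
  qed
  then have "?f ` (A \<times> B) = {..<N}" using assms(1) by auto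
  then have "inj_on ?f (A \<times> B)"
    using assms by (intro eq_card_imp_inj_on) (auto simp: card_cartesian_product)
  then have "a = a' \<and> b = b'"
    if "a \<in> A" "a' \<in> A" "b \<in> B" "b' \<in> B" "[a + b = a' + b'] (mod N)" for a a' b b'
    using that inj_onD[of ?f "A \<times> B" "(a, b)" "(a', b')"] by (simp add: cong_def)
  then show ?thesis unfolding tiles_def using assms by blast
qed

text \<open>If the sums \<open>q * a + b\<close> missed a residue \<open>y\<close>, its count would
  be 0. By Frobenius the Fourier sum of this count is, up to a multiple of \<open>q\<close>, the one
  for \<open>ev A z ^ q * ev B z\<close>, to which only \<open>z = 1\<close> contributes; so
  \<open>q\<close> would divide \<open>card A ^ (q - 1)\<close>.\<close>

lemma tiles_dilate_prime:
  assumes t: "tiles N A B" and q: "prime q" "\<not> q dvd card A"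
  shows "tiles N ((*) q ` A) B"
proof -
  have N: "0 < N" and fin: "finite A" "finite B" using t by (auto simp: tiles_def)
  have q0: "0 < q" using q prime_gt_0_nat by blast
  obtain h where h: "intpoly h" "\<And>z. ev A z ^ q = ev A (z ^ q) + of_nat q * h z"
    using ev_power_prime[OF q(1) fin(1)] by blast
  have "\<exists>a\<in>A. \<exists>b\<in>B. [q * a + b = y] (mod N)" for y
  proof (rule ccontr)
    assume no: "\<not> ?thesis"
    let ?R = "{z. z ^ N = (1::complex)}"
    let ?e = "\<lambda>i. q * fst i + snd i"
    obtain k where k: "k \<in> \<int>" "(\<Sum>z\<in>?R. h z * ev B z * inverse z ^ y) = of_nat N * k"
      using intpoly_Fourier_coeff[OF intpoly_mult[OF h(1) intpoly_ev[of B]] N] by metis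
    have no': "{i\<in>A \<times> B. [?e i = y] (mod N)} = {}" using no by auto
    have "of_nat N * of_nat (card {i\<in>A \<times> B. [?e i = y] (mod N)})
        = (\<Sum>z\<in>?R. (\<Sum>i\<in>A \<times> B. z ^ ?e i) * inverse z ^ y)"
      by (rule count_Fourier_inversion) (use N fin in auto)
    then have "0 = (\<Sum>z\<in>?R. (\<Sum>i\<in>A \<times> B. z ^ ?e i) * inverse z ^ y)"
      unfolding no' by simp
    also have "\<dots> = (\<Sum>z\<in>?R. ev A (z ^ q) * ev B z * inverse z ^ y)"
      by (simp add: ev_def sum_product sum.cartesian_product power_add power_mult case_prod_unfold)
    also have "\<dots> = (\<Sum>z\<in>?R. ev A z ^ q * ev B z * inverse z ^ y
        - of_nat q * (h z * ev B z * inverse z ^ y))"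
    proof (rule sum.cong)
      have "ev A (z ^ q) * ev B z * w = ev A z ^ q * ev B z * w - of_nat q * (h z * ev B z * w)" for z w
        by (simp add: h(2) ring_distribs)
      then show "ev A (z ^ q) * ev B z * inverse z ^ y
          = ev A z ^ q * ev B z * inverse z ^ y - of_nat q * (h z * ev B z * inverse z ^ y)" for z .
    qed simp
    also have "\<dots> = (\<Sum>z\<in>?R. ev A z ^ q * ev B z * inverse z ^ y) - of_nat q * (of_nat N * k)"
      by (simp add: sum_subtractf k(2) flip: sum_distrib_left)
    also have "(\<Sum>z\<in>?R. ev A z ^ q * ev B z * inverse z ^ y)
        = (\<Sum>z\<in>{1}. ev A z ^ q * ev B z * inverse z ^ y)"
      using tiles_ev_eq_0[OF t] q0 N
      by (intro sum.mono_neutral_right) (auto simp: finite_roots_unity)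
    \<comment> \<open>One factor \<open>card A\<close> of the value
      \<open>card A ^ q * card B\<close> joins \<open>card B\<close> to give \<open>N\<close>, which
      cancels against the \<open>N\<close> of the Fourier formula.\<close>
    also have "\<dots> = of_nat N * of_nat (card A) ^ (q - 1)"
    proof -
      have "card A ^ q = card A * card A ^ (q - 1)" using q0 by (cases q) auto
      then have "card A ^ q * card B = N * card A ^ (q - 1)"
        by (simp flip: tiles_card[OF t])
      then show ?thesis
        by (simp flip: of_nat_mult of_nat_power)
    qed
    finally have "of_nat N * (of_nat (card A) ^ (q - 1) - of_nat q * k) = 0"
      by (metis (no_types, opaque_lifting) mult.left_commute right_diff_distrib)
    then have e: "of_nat (card A) ^ (q - 1) = of_nat q * k" using N by simp
    obtain k' where "k = of_int k'" using k(1) Ints_cases by blast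
    with e have "of_int (int (card A) ^ (q - 1)) = (of_int (int q * k') :: complex)" by simp
    then have "int (card A) ^ (q - 1) = int q * k'" by (simp only: of_int_eq_iff)
    then have "int q dvd int (card A ^ (q - 1))" by simp
    then have "q dvd card A ^ (q - 1)" by (simp only: int_dvd_int_iff)
    then show False using q prime_dvd_power by blast
  qed
  moreover have "card ((*) q ` A) = card A"
    using q0 by (intro card_image) (auto simp: inj_on_def)
  ultimately show ?thesis
    using N fin tiles_card[OF t] by (intro tilesI_surj) auto
qed

text \<open>Prime factors of \<open>r\<close> are applied one at a time; each dilation keeps the
  cardinality, so coprimality persists.\<close>

lemma tiles_dilate:
  assumes "tiles N A B" "coprime r (card A)" "0 < r"
  shows "tiles N ((*) r ` A) B"
  using assms(2,3)
proof (induction r rule: less_induct)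
  case (less r)
  show ?case
  proof (cases "r = 1")
    case True
    then show ?thesis using assms by simp
  next
    case False
    then obtain q r' where q: "prime q" "r = q * r'"
      by (metis prime_factor_nat dvdE)
    then have r': "0 < r'" "r' < r" using less prime_gt_1_nat by (auto simp: Suc_lessI)
    have cop: "coprime q (card A)" "coprime r' (card A)" using less q by auto
    have "card ((*) r' ` A) = card A"
      using r' by (intro card_image) (auto simp: inj_on_def)
    moreover have "\<not> q dvd card A"
      using cop q by (metis coprime_absorb_left not_prime_unit)
    ultimately have "tiles N ((*) q ` (*) r' ` A) B"
      using tiles_dilate_prime[OF less.IH[OF r'(2) cop(2) r'(1)] q(1)] by simp
    then show ?thesis using q by (simp add: image_image mult.assoc)
  qed
qed

section \<open>Vanishing at primitive roots of unity, and its count over prime powers\<close>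

lemma coprime_shift:
  fixes r s m :: nat
  assumes "coprime r s" "0 < m"
  shows "\<exists>k. coprime (r + k * s) m"
proof -
  \<comment> \<open>A prime of \<open>m\<close> that divides \<open>r\<close> divides neither
    \<open>s\<close> nor \<open>k\<close>; one that does not divide \<open>r\<close> divides
    \<open>k\<close>. Either way it divides exactly one of \<open>r\<close> and
    \<open>k * s\<close>.\<close>
  define k where "k = \<Prod>{q\<in>prime_factors m. \<not> q dvd r}"
  have "\<not> q dvd r + k * s" if q: "prime q" "q dvd m" for q
  proof (cases "q dvd r")
    case True
    then have "\<not> q dvd s" using assms(1) q by (meson coprime_common_divisor not_prime_unit)
    moreover have "\<not> q dvd k"
    proof
      assume "q dvd k"
      then obtain q' where "q' \<in> prime_factors m" "\<not> q' dvd r" "q dvd q'"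
        using q unfolding k_def by (subst (asm) prime_dvd_prod_iff) auto
      then show False using q True primes_dvd_imp_eq by (metis in_prime_factors_imp_prime)
    qed
    ultimately show ?thesis
      using True q by (simp add: dvd_add_right_iff prime_dvd_mult_iff)
  next
    case False
    then have "q dvd k"
      unfolding k_def using q assms by (intro dvd_prodI) (auto simp: in_prime_factors_iff)
    then show ?thesis using False by (simp add: dvd_add_left_iff)
  qed
  then have "gcd (r + k * s) m = 1" using prime_factor_nat[of "gcd (r + k * s) m"] by auto
  then show ?thesis by (auto simp: coprime_iff_gcd_eq_1)
qed

text \<open>For positive \<open>s\<close> this is divisibility of the mask by the cyclotomic
  polynomial, see \<open>cyclotomic_dvd_mask_iff\<close>.\<close>

definition vanish :: "nat \<Rightarrow> nat set \<Rightarrow> bool" where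
  "vanish s A \<longleftrightarrow> (\<forall>z. primroot s z \<longrightarrow> ev A z = 0)"

text \<open>At each root one of the tiles vanishes, but which one might depend on the root. If
  \<open>ev A z\<close> and \<open>ev B w\<close> are nonzero with \<open>w = z ^ r\<close>,
  dilating \<open>B\<close> by a number congruent to \<open>r\<close> modulo \<open>s\<close> and
  coprime to \<open>card B\<close> moves the value at \<open>w\<close> to \<open>z\<close>, where
  neither tile vanishes. This takes the place of irreducibility of the cyclotomic
  polynomial.\<close>

lemma tiles_vanish:
  assumes t: "tiles N A B" and s: "s dvd N" "1 < s"
  shows "vanish s A \<or> vanish s B"
proof (rule ccontr)
  assume "\<not> ?thesis"
  then obtain z w where z: "primroot s z" "ev A z \<noteq> 0" and w: "primroot s w" "ev B w \<noteq> 0"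
    by (auto simp: vanish_def)
  obtain r where r: "coprime r s" "w = z ^ r" using primroot_conjugate z w by blast
  have N: "0 < N" using t by (auto simp: tiles_def)
  then have "0 < card B" using tiles_card[OF t] by (cases "card B") auto
  then obtain k where k: "coprime (r + k * s) (card B)" using coprime_shift r by blast
  have "0 < r + k * s" using r(1) s(2) by (cases r) auto
  then have t': "tiles N ((*) (r + k * s) ` B) A"
    by (rule tiles_dilate[OF tiles_sym[OF t] k])
  have zs: "z ^ s = 1" using z by (simp add: primroot_def)
  have zr: "z ^ (r + k * s) = w"
    using zs r(2) by (simp add: power_add power_mult mult.commute[of k])
  have "inj_on ((*) (r + k * s)) B" using \<open>0 < r + k * s\<close> by (auto simp: inj_on_def)
  then have "ev ((*) (r + k * s) ` B) z = ev B w"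
    unfolding ev_def by (simp add: sum.reindex power_mult zr)
  moreover have "z ^ N = 1" "z \<noteq> 1" using z s by (auto simp: primroot_def dest!: spec[of _ 1])
  ultimately show False using tiles_ev_eq_0[OF t', of z] z w by auto
qed

lemma primroot_prime_power:
  assumes "prime q" "z ^ (q ^ Suc i) = 1" "z ^ (q ^ i) \<noteq> 1"
  shows "primroot (q ^ Suc i) z"
proof -
  have "0 < q ^ Suc i" using assms prime_gt_0_nat by simp
  then obtain d where d: "d dvd q ^ Suc i" "primroot d z"
    using primroot_order_exists assms by blast
  then obtain j where j: "j \<le> Suc i" "d = q ^ j"
    using divides_primepow_nat[OF assms(1)] by blast
  have "\<not> d dvd q ^ i" using assms d by (auto simp: primroot_def)
  then have "j = Suc i" using j le_imp_power_dvd[of j i q] by (cases "j \<le> i") auto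
  then show ?thesis using d j by simp
qed

text \<open>Passing from \<open>q ^ i\<close> to \<open>q ^ Suc i\<close> in the Fourier formula
  adds only primitive roots of order \<open>q ^ Suc i\<close>, where \<open>A\<close> vanishes.
  Hence each class modulo \<open>q ^ i\<close> is spread evenly over its lifts.\<close>

lemma vanish_prime_power_equidistributed:
  assumes "prime q" "finite A" "vanish (q ^ Suc i) A"
  shows "card {a\<in>A. [a = x] (mod q ^ i)} = q * card {a\<in>A. [a = x] (mod q ^ Suc i)}"
proof -
  have q: "0 < q" using assms prime_gt_0_nat by blast
  have sub: "z ^ (q ^ Suc i) = 1" if "z ^ (q ^ i) = 1" for z :: complex
    using that by (metis power_Suc2 power_mult power_one)
  have inv: "of_nat (q ^ i) * of_nat (card {a\<in>A. [a = x] (mod q ^ i)})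
      = (\<Sum>z | z ^ (q ^ i) = (1::complex). ev A z * inverse z ^ x)" for i
    unfolding ev_def using q assms by (intro count_Fourier_inversion) auto
  have "(\<Sum>z | z ^ (q ^ i) = (1::complex). ev A z * inverse z ^ x)
      = (\<Sum>z | z ^ (q ^ Suc i) = (1::complex). ev A z * inverse z ^ x)"
  proof (rule sum.mono_neutral_left)
    show "finite {z. z ^ q ^ Suc i = (1::complex)}" using q by (intro finite_roots_unity) (simp add: Suc_leI)
    show "{z. z ^ q ^ i = (1::complex)} \<subseteq> {z. z ^ q ^ Suc i = 1}" using sub by blast
    show "\<forall>z\<in>{z. z ^ q ^ Suc i = (1::complex)} - {z. z ^ q ^ i = 1}. ev A z * inverse z ^ x = 0"
    proof
      fix z assume "z \<in> {z. z ^ q ^ Suc i = (1::complex)} - {z. z ^ q ^ i = 1}"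
      then have "primroot (q ^ Suc i) z" using assms(1) by (intro primroot_prime_power) auto
      then show "ev A z * inverse z ^ x = 0" using assms(3) by (simp add: vanish_def)
    qed
  qed
  then have "(of_nat (q ^ i * card {a\<in>A. [a = x] (mod q ^ i)}) :: complex)
      = of_nat (q ^ Suc i * card {a\<in>A. [a = x] (mod q ^ Suc i)})"
    unfolding of_nat_mult inv .
  then have "q ^ i * card {a\<in>A. [a = x] (mod q ^ i)} = q ^ Suc i * card {a\<in>A. [a = x] (mod q ^ Suc i)}"
    by (simp only: of_nat_eq_iff)
  then show ?thesis using q by simp
qed

lemma card_residue_refine:
  fixes A :: "nat set"
  assumes "finite A" "0 < q" "0 < m"
  shows "card {a\<in>A. [a = x] (mod m)} = (\<Sum>t<q. card {a\<in>A. [a = x + t * m] (mod q * m)})"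
proof -
  have "{a\<in>A. [a = x] (mod m)} = (\<Union>t\<in>{..<q}. {a\<in>A. [a = x + t * m] (mod q * m)})"
  proof (intro equalityI subsetI)
    fix a assume a: "a \<in> {a\<in>A. [a = x] (mod m)}"
    \<comment> \<open>Adding a multiple of \<open>q * m\<close> makes the representative at least
      \<open>x\<close>, so that the difference is a natural number.\<close>
    define c where "c = a + q * m * x"
    have "1 * x \<le> (q * m) * x" using assms by (intro mult_le_mono) (auto simp: Suc_leI)
    then have "x \<le> c" unfolding c_def by linarith
    moreover have "[c = x] (mod m)"
      using a by (simp add: c_def cong_def mult.assoc mult.left_commute[of q])
    ultimately obtain k where k: "c = k * m + x" using cong_le_nat by blast
    have "[a = c] (mod q * m)" by (simp add: c_def cong_def)
    also have "c = k * m + x" by (rule k)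
    also have "[k * m + x = x + (k mod q) * m] (mod q * m)"
      by (simp add: add.commute cong_add_lcancel_nat cong_cmult_rightI)
    finally show "a \<in> (\<Union>t\<in>{..<q}. {a\<in>A. [a = x + t * m] (mod q * m)})"
      using a assms by (intro UN_I[of "k mod q"]) auto
  next
    fix a assume "a \<in> (\<Union>t\<in>{..<q}. {a\<in>A. [a = x + t * m] (mod q * m)})"
    then obtain t where "a \<in> A" "[a = x + t * m] (mod q * m)" by blast
    then have "[a = x + t * m] (mod m)" using cong_dvd_modulus_nat[of a _ "q * m" m] by simp
    then show "a \<in> {a\<in>A. [a = x] (mod m)}" using \<open>a \<in> A\<close> by (simp add: cong_def)
  qed
  moreover have "t = t'" if "t < q" "t' < q" "[a = x + t * m] (mod q * m)" "[a = x + t' * m] (mod q * m)" for a t t'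
  proof -
    have "[x + t * m = x + t' * m] (mod q * m)" using that cong_trans cong_sym by blast
    then have "[t * m = t' * m] (mod q * m)" by (simp add: cong_add_lcancel_nat)
    then have "t * m = t' * m"
      using that assms by (intro cong_less_modulus_unique_nat) auto
    then show ?thesis using assms by simp
  qed
  ultimately show ?thesis using assms by (simp only:) (subst card_UN_disjoint, auto)
qed

lemma prime_power_dvd_card:
  assumes q: "prime q" and "finite A" "finite J" and J: "\<And>j. j \<in> J \<Longrightarrow> 1 \<le> j \<and> vanish (q ^ j) A"
  shows "q ^ card J dvd card A"
proof -
  have q0: "0 < q" using q prime_gt_0_nat by blast
  obtain K where K: "J \<subseteq> {..K}" using \<open>finite J\<close> finite_nat_set_iff_bounded_le by (metis atMost_iff subsetI)
  \<comment> \<open>Downward induction on the depth \<open>d\<close>: a class modulo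
    \<open>q ^ d\<close> gains one factor \<open>q\<close> for each level of \<open>J\<close> above
    \<open>d\<close>.\<close>
  have "\<forall>x. q ^ card (J \<inter> {d<..K}) dvd card {a\<in>A. [a = x] (mod q ^ d)}" if "d \<le> K" for d
    using that
  proof (induction d rule: inc_induct)
    case base
    show ?case by simp
  next
    case (step d)
    show ?case
    proof
      fix x
      have split: "{d<..K} = insert (Suc d) {Suc d<..K}" using step by auto
      show "q ^ card (J \<inter> {d<..K}) dvd card {a\<in>A. [a = x] (mod q ^ d)}"
      proof (cases "Suc d \<in> J")
        case True
        then have "card (J \<inter> {d<..K}) = Suc (card (J \<inter> {Suc d<..K}))"
          unfolding split by simp
        moreover have "card {a\<in>A. [a = x] (mod q ^ d)} = q * card {a\<in>A. [a = x] (mod q ^ Suc d)}"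
          using J[OF True] assms by (intro vanish_prime_power_equidistributed) auto
        ultimately show ?thesis using step.IH by (simp add: mult_dvd_mono)
      next
        case False
        then have "J \<inter> {d<..K} = J \<inter> {Suc d<..K}" unfolding split by auto
        moreover have "card {a\<in>A. [a = x] (mod q ^ d)}
            = (\<Sum>t<q. card {a\<in>A. [a = x + t * q ^ d] (mod q ^ Suc d)})"
          using card_residue_refine[OF \<open>finite A\<close> q0, of "q ^ d" x] q0 by simp
        ultimately show ?thesis using step.IH by (simp add: dvd_sum)
      qed
    qed
  qed
  from this[of 0] have "q ^ card (J \<inter> {0<..K}) dvd card A" by (auto dest: spec[of _ 0])
  moreover have "J \<inter> {0<..K} = J" using K J by force
  ultimately show ?thesis by simp
qed

text \<open>Let \<open>v\<close> be the exponent of \<open>q\<close> in \<open>N\<close>. The levels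
  of \<open>A\<close> and of \<open>B\<close> together cover \<open>{1..v}\<close>, while each level
  puts a factor \<open>q\<close> into a cardinality, so there are at most \<open>v\<close> of them.
  An overlap or a level beyond \<open>v\<close> would be one too many.\<close>

lemma tiles_vanish_prime_power:
  assumes t: "tiles N A B" and q: "prime q" "1 \<le> i" "vanish (q ^ i) A"
  shows "q ^ i dvd N" "\<not> vanish (q ^ i) B"
proof -
  have N: "0 < N" and fin: "finite A" "finite B" using t by (auto simp: tiles_def)
  define v where "v = multiplicity q N"
  define IA where "IA = {j\<in>{1..v}. vanish (q ^ j) A}"
  define IB where "IB = {j\<in>{1..v}. vanish (q ^ j) B}"
  have v: "q ^ j dvd N \<longleftrightarrow> j \<le> v" for j
    unfolding v_def using q N by (intro power_dvd_iff_le_multiplicity) auto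
  have "IA \<union> IB = {1..v}"
  proof -
    have "vanish (q ^ j) A \<or> vanish (q ^ j) B" if "1 \<le> j" "j \<le> v" for j
    proof -
      have "1 < q ^ j" using that prime_gt_1_nat[OF q(1)] by (intro one_less_power) auto
      then show ?thesis using that v by (intro tiles_vanish[OF t]) auto
    qed
    then show ?thesis unfolding IA_def IB_def atLeastAtMost_iff by force
  qed
  then have un: "card (IA \<union> IB) = v" by simp
  have fIA: "finite IA" "finite IB" by (auto simp: IA_def IB_def)
  \<comment> \<open>Stated for arbitrary index sets so that it also applies to \<open>IA\<close>
    enlarged by a level above \<open>v\<close>.\<close>
  have le: "card IA' + card IB' \<le> v" if "finite IA'" "finite IB'"
      "\<And>j. j \<in> IA' \<Longrightarrow> 1 \<le> j \<and> vanish (q ^ j) A" "\<And>j. j \<in> IB' \<Longrightarrow> 1 \<le> j \<and> vanish (q ^ j) B" for IA' IB'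
  proof -
    have "q ^ card IA' dvd card A" "q ^ card IB' dvd card B"
      using that q fin by (auto intro: prime_power_dvd_card)
    then have "q ^ (card IA' + card IB') dvd N"
      unfolding tiles_card[OF t, symmetric] power_add by (rule mult_dvd_mono)
    then show ?thesis using v by blast
  qed
  have vA: "j \<in> IA \<Longrightarrow> 1 \<le> j \<and> vanish (q ^ j) A" and vB: "j \<in> IB \<Longrightarrow> 1 \<le> j \<and> vanish (q ^ j) B" for j
    by (auto simp: IA_def IB_def)
  have cU: "card (IA \<union> IB) + card (IA \<inter> IB) = card IA + card IB"
    using card_Un_Int[OF fIA] by simp
  show dvd: "q ^ i dvd N"
  proof (rule ccontr)
    assume "\<not> q ^ i dvd N"
    then have "i \<notin> IA" using v by (auto simp: IA_def)
    then have "card (insert i IA) = Suc (card IA)" using fIA by simp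
    moreover have "card (insert i IA) + card IB \<le> v"
      using fIA vA vB q by (intro le) auto
    ultimately show False using un cU by linarith
  qed
  show "\<not> vanish (q ^ i) B"
  proof
    assume "vanish (q ^ i) B"
    then have "i \<in> IA \<inter> IB" using q dvd v by (auto simp: IA_def IB_def)
    then have "0 < card (IA \<inter> IB)" using fIA by (auto simp: card_gt_0_iff)
    moreover have "card IA + card IB \<le> v" using fIA vA vB by (intro le) auto
    ultimately show False using un cU by linarith
  qed
qed

subsection \<open>Reductions of condition (T2) to smaller moduli\<close>

text \<open>(T2) indexed by the product \<open>s\<close> instead of the set of its prime powers, and
  restricted to divisors of \<open>N\<close>; for a tile modulo \<open>N\<close> no other prime
  powers occur.\<close>

definition T2_mod :: "nat \<Rightarrow> nat set \<Rightarrow> bool" where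
  "T2_mod N A \<longleftrightarrow> (\<forall>s. s dvd N \<longrightarrow> 1 < s \<longrightarrow>
    (\<forall>q\<in>prime_factors s. vanish (q ^ multiplicity q s) A) \<longrightarrow> vanish s A)"

lemma T2_modD:
  "T2_mod N A \<Longrightarrow> s dvd N \<Longrightarrow> 1 < s \<Longrightarrow>
    (\<And>q. prime q \<Longrightarrow> q dvd s \<Longrightarrow> vanish (q ^ multiplicity q s) A) \<Longrightarrow> vanish s A"
  unfolding T2_mod_def by (auto simp: in_prime_factors_iff)

lemma multiplicity_pos:
  fixes q s :: nat
  shows "prime q \<Longrightarrow> q dvd s \<Longrightarrow> 0 < s \<Longrightarrow> 1 \<le> multiplicity q s"
  using multiplicity_gt_zero_iff[of s q] prime_gt_1_nat[of q] by (simp add: Suc_le_eq)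

lemma not_vanish_prime_power:
  assumes "prime q" "finite A" "\<not> q dvd card A" "1 \<le> i"
  shows "\<not> vanish (q ^ i) A"
  using prime_power_dvd_card[of q A "{i}"] assms by auto

text \<open>The common complement links the tiles: where \<open>A\<close> vanishes \<open>B\<close>
  does not, so \<open>A'\<close> must.\<close>

lemma tiles_vanish_transfer:
  assumes "tiles N A B" "tiles N' A' B" "prime q" "1 \<le> i" "q ^ i dvd N'" "vanish (q ^ i) A"
  shows "vanish (q ^ i) A'"
proof -
  have "1 < q ^ i" using assms prime_gt_1_nat[of q] by (intro one_less_power) auto
  then show ?thesis
    using tiles_vanish_prime_power(2)[OF assms(1,3,4,6)] tiles_vanish[OF assms(2,5)] by blast
qed

lemma primroot_power_dvd:
  assumes "primroot s z" "q dvd s"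
  shows "primroot (s div q) (z ^ q)"
proof -
  obtain t where t: "s = q * t" using assms by blast
  then have "0 < q" "0 < t" using assms by (auto simp: primroot_def)
  then show ?thesis using assms t by (simp add: primroot_def flip: power_mult)
qed

text \<open>Elements of the dilated tile are multiples of \<open>q\<close>, so a sum has the residue
  of \<open>b\<close> modulo \<open>q\<close>. Each residue class of \<open>B\<close> therefore
  tiles its own coset of the multiples of \<open>q\<close>, and division by \<open>q\<close>
  rescales it.\<close>

lemma tiles_section:
  assumes t: "tiles (q * K) ((*) q ` A) B" and r: "r < q"
  shows "tiles K A ((\<lambda>b. b div q) ` {b\<in>B. b mod q = r})"
  unfolding tiles_def
proof (intro conjI ballI impI allI)
  have "0 < q * K" "finite ((*) q ` A)" and fB: "finite B" using t by (auto simp: tiles_def)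
  then show K: "0 < K" and "finite A" and "finite ((\<lambda>b. b div q) ` {b\<in>B. b mod q = r})"
    using finite_imageD[of "(*) q" A] by (auto simp: inj_on_def)
  {
    fix a a' c c'
    assume a: "a \<in> A" "a' \<in> A" and c: "c \<in> (\<lambda>b. b div q) ` {b\<in>B. b mod q = r}"
      "c' \<in> (\<lambda>b. b div q) ` {b\<in>B. b mod q = r}" and e: "[a + c = a' + c'] (mod K)"
    then obtain b b' where b: "b \<in> B" "b' \<in> B" "c = b div q" "c' = b' div q" "b mod q = r" "b' mod q = r"
      by blast
    have "b = q * c + r" "b' = q * c' + r" using b by (metis mult_div_mod_eq)+
    moreover have "[q * (a + c) + r = q * (a' + c') + r] (mod q * K)"
      using e by (simp only: cong_add_rcancel_nat cong_cmult_leftI)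
    ultimately have "[q * a + b = q * a' + b'] (mod q * K)" by (simp add: algebra_simps)
    then have "q * a = q * a' \<and> b = b'" using a b by (intro tiles_inj[OF t]) auto
    then show "a = a'" "c = c'" using b r by auto
  }
  fix y
  obtain a' b where ab: "a' \<in> (*) q ` A" "b \<in> B" "[a' + b = q * y + r] (mod q * K)"
    using tiles_surj[OF t] .
  then obtain a where a: "a \<in> A" "a' = q * a" by blast
  have "[q * a + b = q * y + r] (mod q)"
    using cong_dvd_modulus_nat[OF ab(3), of q] a by simp
  then have br: "b mod q = r" using r by (simp add: cong_def)
  then have "b = q * (b div q) + r" by (metis mult_div_mod_eq)
  with ab(3) a have "[q * (a + b div q) + r = q * y + r] (mod q * K)"
    by (metis add.assoc distrib_left)
  then have "[q * (a + b div q) = q * y] (mod q * K)" by (simp only: cong_add_rcancel_nat)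
  then have "[a + b div q = y] (mod K)" using r by (simp add: cong_def mod_mult_mult1)
  then show "\<exists>a\<in>A. \<exists>c\<in>(\<lambda>b. b div q) ` {b\<in>B. b mod q = r}. [a + c = y] (mod K)"
    using a ab br by blast
qed

lemma ev_sections:
  assumes "finite B" "0 < q"
  shows "ev B z = (\<Sum>r<q. z ^ r * ev ((\<lambda>b. b div q) ` {b\<in>B. b mod q = r}) (z ^ q))"
proof -
  have inj: "inj_on (\<lambda>b. b div q) {b\<in>B. b mod q = r}" for r
    by (rule inj_onI) (metis (mono_tags, lifting) mem_Collect_eq mult_div_mod_eq)
  have "z ^ r * ev ((\<lambda>b. b div q) ` {b\<in>B. b mod q = r}) (z ^ q) = (\<Sum>b\<in>{b\<in>B. b mod q = r}. z ^ b)" for r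
    unfolding ev_def sum.reindex[OF inj] sum_distrib_left
  proof (rule sum.cong)
    fix b assume "b \<in> {b\<in>B. b mod q = r}"
    then have "b = r + q * (b div q)" by auto
    then show "z ^ r * ((\<lambda>a. (z ^ q) ^ a) \<circ> (\<lambda>b. b div q)) b = z ^ b"
      by (metis comp_apply power_add power_mult)
  qed simp
  then have "(\<Sum>r<q. z ^ r * ev ((\<lambda>b. b div q) ` {b\<in>B. b mod q = r}) (z ^ q))
      = (\<Sum>r<q. \<Sum>b\<in>{b\<in>B. b mod q = r}. z ^ b)" by simp
  also have "\<dots> = ev B z"
    unfolding ev_def using assms by (intro sum.group) auto
  finally show ?thesis by simp
qed

text \<open>After dilating \<open>A\<close> by \<open>q\<close>, each section of \<open>B\<close>
  complements \<open>A\<close> modulo \<open>N div q\<close>. For \<open>A\<close>, only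
  \<open>s\<close> prime to \<open>q\<close> matter, since \<open>A\<close> vanishes at no power of
  \<open>q\<close>. For \<open>B\<close>, \<open>z ^ q\<close> has order \<open>s'\<close>, all
  sections vanish there, and \<open>ev_sections\<close> reassembles \<open>B\<close>.\<close>

lemma T2_mod_reduce_prime:
  assumes t: "tiles N A B" and q: "prime q" "q dvd N" "\<not> q dvd card A"
    and IH: "\<And>A' B'. tiles (N div q) A' B' \<Longrightarrow> T2_mod (N div q) A' \<and> T2_mod (N div q) B'"
  shows "T2_mod N A \<and> T2_mod N B"
proof -
  obtain K where N: "N = q * K" using q by blast
  have q0: "0 < q" using q prime_gt_0_nat by blast
  have K0: "0 < K" and fin: "finite A" "finite B" using t N by (auto simp: tiles_def)
  have NK: "N div q = K" using N q0 by simp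
  define S where "S = (\<lambda>r. (\<lambda>b. b div q) ` {b\<in>B. b mod q = r})"
  have tS: "tiles K A (S r)" if "r < q" for r
    using tiles_dilate_prime[OF t q(1,3)] that unfolding N S_def by (rule tiles_section)
  have TA: "T2_mod K A" and TS: "r < q \<Longrightarrow> T2_mod K (S r)" for r
    using IH tS q0 unfolding NK by blast+
  have div_K: "s dvd K" if "s dvd N" "\<not> q dvd s" for s
    using that q(1) N by (metis coprime_commute coprime_dvd_mult_right_iff prime_imp_coprime)
  have "vanish s A" if s: "s dvd N" "1 < s" "\<forall>l\<in>prime_factors s. vanish (l ^ multiplicity l s) A" for s
  proof -
    have "\<not> q dvd s"
    proof
      assume qs: "q dvd s"
      then have "1 \<le> multiplicity q s" using q s by (intro multiplicity_pos) auto
      then have "\<not> vanish (q ^ multiplicity q s) A"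
        by (rule not_vanish_prime_power[OF q(1) fin(1) q(3)])
      moreover have "q \<in> prime_factors s" using q qs s(2) by (simp add: in_prime_factors_iff)
      ultimately show False using s(3) by blast
    qed
    then show ?thesis using TA s div_K by (auto simp: T2_mod_def)
  qed
  moreover have "vanish s B" if s: "s dvd N" "1 < s" "\<forall>l\<in>prime_factors s. vanish (l ^ multiplicity l s) B" for s
  \<comment> \<open>For \<open>s = q\<close> the reduced order would be 1, outside the range of
    \<open>T2_mod\<close>; there the hypothesis is already the conclusion.\<close>
  proof (cases "s = q")
    case True
    then have "vanish (q ^ multiplicity q q) B"
      using s(3) q(1) by (simp add: prime_prime_factors)
    moreover have "multiplicity q q = 1" using q(1) by simp
    ultimately show ?thesis using True by simp
  next
    case False
    define s' where "s' = (if q dvd s then s div q else s)"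
    have s': "s' dvd K"
      using div_K[OF s(1)] s(1) N q0 by (auto simp: s'_def div_dvd_iff_mult mult.commute)
    have s'1: "1 < s'"
    proof -
      have "s' \<noteq> 1" using dvd_mult_div_cancel[of q s] False s(2) by (auto simp: s'_def)
      moreover have "s' \<noteq> 0" using s' K0 by (auto intro: Nat.gr0I)
      ultimately show ?thesis by simp
    qed
    have mult: "multiplicity l s' = multiplicity l s" if "prime l" "l \<noteq> q" for l
    proof (cases "q dvd s")
      case True
      then have "s = q * s'" by (simp add: s'_def)
      then have "multiplicity l s = multiplicity l q + multiplicity l s'"
        using that q s'1 by (simp add: prime_elem_multiplicity_mult_distrib)
      then show ?thesis using that q by (simp add: multiplicity_distinct_prime_power[of l q 1, simplified])
    qed (simp add: s'_def)
    have van: "vanish s' (S r)" if r: "r < q" for r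
    proof (rule T2_modD[OF TS[OF r] s' s'1])
      fix l assume l: "prime l" "l dvd s'"
      let ?i = "multiplicity l s'"
      have i: "1 \<le> ?i" using l s'1 by (intro multiplicity_pos) auto
      \<comment> \<open>Nonvanishing of \<open>A\<close> is what carries over to the sections. For
        \<open>l = q\<close> it follows from the cardinality, otherwise from vanishing of
        \<open>B\<close>.\<close>
      have "\<not> vanish (l ^ ?i) A"
      proof (cases "l = q")
        case True
        then show ?thesis using not_vanish_prime_power[OF q(1) fin(1) q(3) i] by simp
      next
        case False
        have "l dvd s" using l(2) by (auto simp: s'_def split: if_splits dest: dvd_trans)
        then have "vanish (l ^ ?i) B"
          using s l mult[OF l(1) False] by (auto simp: in_prime_factors_iff)
        then show ?thesis using tiles_vanish_prime_power(2)[OF tiles_sym[OF t] l(1) i] by blast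
      qed
      moreover have "1 < l ^ ?i" using l i prime_gt_1_nat by (intro one_less_power) auto
      moreover have "l ^ ?i dvd K" using multiplicity_dvd[of l s'] s' dvd_trans by blast
      ultimately show "vanish (l ^ ?i) (S r)" using tiles_vanish[OF tS[OF r]] by blast
    qed
    show ?thesis unfolding vanish_def
    proof (intro allI impI)
      fix z assume z: "primroot s z"
      have "primroot s' (z ^ q)"
        using primroot_power_dvd[OF z] primroot_power[OF z, of q] q(1)
        by (auto simp: s'_def prime_imp_coprime)
      then have "ev (S r) (z ^ q) = 0" if "r < q" for r
        using van[OF that] by (simp add: vanish_def)
      then show "ev B z = 0"
        using ev_sections[OF fin(2) q0, of z] by (simp add: S_def)
    qed
  qed
  ultimately show ?thesis unfolding T2_mod_def by blast
qed

text \<open>Only the \<open>A\<close>-component varies, so \<open>A\<close> can be cut down to the residues in a section of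
  \<open>\<int>/p ^ Suc k \<rightarrow> \<int>/p ^ k\<close>; the freedom in choosing the section carries (T2) back to \<open>A\<close>.\<close>

locale slab_tiling =
  fixes p k L m :: nat and A B :: "nat set"
  assumes p: "prime p" and m: "m = p ^ k" and pL: "coprime p L"
    and t: "tiles (p * m * L) A B"
    and uniform: "\<And>a a' b b'. a \<in> A \<Longrightarrow> a' \<in> A \<Longrightarrow> b \<in> B \<Longrightarrow> b' \<in> B \<Longrightarrow>
      [a + b = a' + b'] (mod m * L) \<Longrightarrow> [b = b'] (mod p * m)"
begin

definition layer :: "nat \<Rightarrow> nat \<Rightarrow> nat set" where
  "layer w j = {a\<in>A. a mod (p * m) = w + m * j}"

text \<open>For each residue \<open>w\<close> modulo \<open>m\<close>, the value
  \<open>\<rho> w\<close> selects the lift \<open>w + m * \<rho> w\<close> modulo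
  \<open>p * m\<close>.\<close>

definition slab :: "(nat \<Rightarrow> nat) \<Rightarrow> nat set" where
  "slab \<rho> = {a\<in>A. a mod (p * m) = a mod m + m * \<rho> (a mod m)}"

lemma p_gt_1: "1 < p" and p_pos: "0 < p" and m_pos: "0 < m"
  using p prime_gt_1_nat[of p] by (auto simp: m)

lemma L_pos: "0 < L" and finA: "finite A" and finB: "finite B"
  using t by (auto simp: tiles_def)

lemma coprime_PL: "coprime (p * m) L" and coprime_mL: "coprime m L"
  using pL by (auto simp: m)

lemma layer_bound: "w < m \<Longrightarrow> j < p \<Longrightarrow> w + m * j < p * m"
proof -
  assume "w < m" "j < p"
  then have "w + m * j < m * Suc j" by simp
  also have "\<dots> \<le> m * p" using \<open>j < p\<close> by (intro mult_le_mono2) simp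
  finally show ?thesis by (simp add: mult.commute)
qed

text \<open>For uniqueness, \<open>uniform\<close> fixes \<open>b\<close> modulo
  \<open>p * m\<close>, hence \<open>a\<close> modulo \<open>m\<close>, and the section raises this
  to \<open>p * m\<close>, where the original tiling decides.\<close>

lemma tiles_slab:
  assumes \<rho>: "\<And>w. w < m \<Longrightarrow> \<rho> w < p"
  shows "tiles (m * L) (slab \<rho>) B"
  unfolding tiles_def
proof (intro conjI ballI impI allI)
  show "0 < m * L" "finite (slab \<rho>)" "finite B"
    using m_pos L_pos finA finB by (auto simp: slab_def)
  {
    fix a a' b b'
    assume a: "a \<in> slab \<rho>" "a' \<in> slab \<rho>" and b: "b \<in> B" "b' \<in> B" and e: "[a + b = a' + b'] (mod m * L)"
    have aA: "a \<in> A" "a' \<in> A" using a by (auto simp: slab_def)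
    have bb: "[b = b'] (mod p * m)" using uniform aA b e by blast
    have em: "[a + b = a' + b'] (mod m)" and eL: "[a + b = a' + b'] (mod L)"
      using e by (auto intro: cong_dvd_modulus_nat)
    have "[b = b'] (mod m)" using bb by (auto intro: cong_dvd_modulus_nat)
    then have "[a = a'] (mod m)" using em
      by (metis cong_add_lcancel_nat cong_add_rcancel_nat cong_trans cong_sym)
    then have "[a = a'] (mod p * m)" using a by (simp add: slab_def cong_def)
    then have "[a + b = a' + b'] (mod p * m)" using bb by (rule cong_add)
    then have "[a + b = a' + b'] (mod p * m * L)"
      using eL coprime_PL by (rule coprime_cong_mult_nat)
    then show "a = a'" "b = b'" using tiles_inj[OF t aA b] by auto
  }
  fix y
  obtain a0 b0 where 0: "a0 \<in> A" "b0 \<in> B" "[a0 + b0 = y] (mod p * m * L)"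
    using tiles_surj[OF t] .
  \<comment> \<open>Existence: \<open>c\<close> is the selected lift of the residue of
    \<open>a0\<close>. Representing the element that is \<open>c + b0\<close> modulo
    \<open>p * m\<close> and \<open>y\<close> modulo \<open>L\<close> keeps the class modulo
    \<open>m * L\<close>, so \<open>uniform\<close> gives \<open>b\<close> the residue of
    \<open>b0\<close>, and \<open>a\<close> gets the residue \<open>c\<close>.\<close>
  define c where "c = a0 mod m + m * \<rho> (a0 mod m)"
  have c: "c < p * m" "c mod m = a0 mod m"
    unfolding c_def using layer_bound \<rho> m_pos by auto
  obtain v where v: "[v = c + b0] (mod p * m)" "[v = y] (mod L)"
    using binary_chinese_remainder_nat[OF coprime_PL] by blast
  obtain a b where ab: "a \<in> A" "b \<in> B" "[a + b = v] (mod p * m * L)"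
    using tiles_surj[OF t] .
  have abP: "[a + b = c + b0] (mod p * m)"
    using v(1) cong_dvd_modulus_nat[OF ab(3), of "p * m"] by (auto intro: cong_trans)
  have abL: "[a + b = y] (mod L)"
    using v(2) cong_dvd_modulus_nat[OF ab(3), of L] by (auto intro: cong_trans)
  have 0: "a0 \<in> A" "b0 \<in> B" "[a0 + b0 = y] (mod m * L)"
    using 0 by (auto intro: cong_dvd_modulus_nat)
  have "[c + b0 = a0 + b0] (mod m)" using c by (simp only: cong_add_rcancel_nat) (simp add: cong_def)
  moreover have "[a + b = c + b0] (mod m)" using abP by (auto intro: cong_dvd_modulus_nat)
  ultimately have "[a + b = a0 + b0] (mod m)" by (rule cong_trans[rotated])
  moreover have "[a + b = a0 + b0] (mod L)"
    using abL cong_dvd_modulus_nat[OF 0(3), of L] by (auto intro: cong_trans cong_sym)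
  ultimately have e: "[a + b = a0 + b0] (mod m * L)"
    using coprime_mL by (rule coprime_cong_mult_nat)
  then have "[b = b0] (mod p * m)" using uniform ab 0 by blast
  then have "[a = c] (mod p * m)" using abP
    by (metis cong_add_lcancel_nat cong_add_rcancel_nat cong_trans cong_sym)
  then have "a mod (p * m) = c" using c by (simp add: cong_def)
  moreover from this have "a mod m = a0 mod m" using c(2)
    by (metis dvd_triv_right mod_mod_cancel)
  ultimately have "a \<in> slab \<rho>" using ab by (simp add: slab_def c_def)
  moreover have "[a + b = y] (mod m * L)" using e 0(3) by (rule cong_trans)
  ultimately show "\<exists>a\<in>slab \<rho>. \<exists>b\<in>B. [a + b = y] (mod m * L)" using ab by blast
qed

lemma ev_slab:
  assumes \<rho>: "\<And>w. w < m \<Longrightarrow> \<rho> w < p"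
  shows "ev (slab \<rho>) z = (\<Sum>w<m. ev (layer w (\<rho> w)) z)"
proof -
  have "ev (slab \<rho>) z = (\<Sum>w<m. \<Sum>a\<in>{a\<in>slab \<rho>. a mod m = w}. z ^ a)"
    unfolding ev_def using finA m_pos by (intro sum.group[symmetric]) (auto simp: slab_def)
  also have "\<dots> = (\<Sum>w<m. ev (layer w (\<rho> w)) z)"
  proof (rule sum.cong)
    fix w assume w: "w \<in> {..<m}"
    have "a mod m = w" if "a mod (p * m) = w + m * \<rho> w" for a
    proof -
      have "a mod m = a mod (p * m) mod m" by (simp add: mod_mod_cancel)
      then show ?thesis using that w by simp
    qed
    then have "{a\<in>slab \<rho>. a mod m = w} = layer w (\<rho> w)"
      by (auto simp: slab_def layer_def)
    then show "(\<Sum>a\<in>{a\<in>slab \<rho>. a mod m = w}. z ^ a) = ev (layer w (\<rho> w)) z"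
      by (simp add: ev_def)
  qed simp
  finally show ?thesis .
qed

lemma sum_layers: "(\<Sum>a\<in>A. f a) = (\<Sum>w<m. \<Sum>j<p. \<Sum>a\<in>layer w j. f a)"
proof -
  have "(\<Sum>w<m. \<Sum>j<p. \<Sum>a\<in>layer w j. f a) = (\<Sum>(w, j)\<in>{..<m} \<times> {..<p}. \<Sum>a\<in>layer w j. f a)"
    by (simp add: sum.cartesian_product)
  also have "\<dots> = (\<Sum>i\<in>{..<m} \<times> {..<p}. \<Sum>a\<in>{a\<in>A. (a mod m, a mod (p * m) div m) = i}. f a)"
  proof (rule sum.cong)
    fix i assume i: "i \<in> {..<m} \<times> {..<p}"
    obtain w j where wj: "i = (w, j)" by fastforce
    have "a mod (p * m) = w + m * j \<longleftrightarrow> a mod m = w \<and> a mod (p * m) div m = j" for a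
    proof -
      have "a mod m = a mod (p * m) mod m" by (simp add: mod_mod_cancel)
      then show ?thesis using i wj by (auto simp: div_mult_self4)
    qed
    then have "layer w j = {a\<in>A. (a mod m, a mod (p * m) div m) = i}"
      by (auto simp: layer_def wj)
    then show "(case i of (w, j) \<Rightarrow> \<Sum>a\<in>layer w j. f a) = (\<Sum>a\<in>{a\<in>A. (a mod m, a mod (p * m) div m) = i}. f a)"
      by (simp add: wj)
  qed simp
  also have "\<dots> = (\<Sum>a\<in>A. f a)"
    using finA m_pos p_pos
    by (intro sum.group) (auto simp: less_mult_imp_div_less)
  finally show ?thesis by simp
qed

text \<open>Changing the section at the single residue \<open>w\<close> exchanges one layer and
  leaves the others alone.\<close>

lemma ev_layer_eq:
  assumes c: "\<And>\<rho>. (\<And>w. \<rho> w < p) \<Longrightarrow> ev (slab \<rho>) z = c" and "w < m" "j < p"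
  shows "ev (layer w j) z = ev (layer w 0) z"
proof -
  let ?\<rho> = "(\<lambda>_. 0)(w := j)"
  have "ev (slab ?\<rho>) z = ev (slab (\<lambda>_. 0)) z"
    using c[of ?\<rho>] c[of "\<lambda>_. 0"] assms p_pos by auto
  then have "(\<Sum>v<m. ev (layer v (?\<rho> v)) z) = (\<Sum>v<m. ev (layer v 0) z)"
    using ev_slab[of ?\<rho> z] ev_slab[of "\<lambda>_. 0" z] assms p_pos by auto
  moreover have "(\<Sum>v<m. ev (layer v (?\<rho> v)) z)
      = ev (layer w j) z + (\<Sum>v\<in>{..<m} - {w}. ev (layer v 0) z)"
    using assms by (subst sum.remove[of _ w]) (auto intro!: sum.cong)
  moreover have "(\<Sum>v<m. ev (layer v 0) z)
      = ev (layer w 0) z + (\<Sum>v\<in>{..<m} - {w}. ev (layer v 0) z)"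
    using assms by (subst sum.remove[of _ w]) auto
  ultimately show ?thesis by simp
qed

text \<open>Factor \<open>z = x * y\<close> with \<open>x\<close> of order \<open>p * m\<close> and
  \<open>y\<close> of order \<open>s\<close>. The layers over a fixed \<open>w\<close> have equal
  values at \<open>y\<close>, so the sum over \<open>j\<close> is a geometric sum of the nontrivial
  \<open>p\<close>-th root of unity \<open>x ^ m\<close>, which is 0.\<close>

lemma vanish_top:
  assumes s: "coprime p s" "0 < s" and van: "s = 1 \<or> (\<forall>\<rho>. (\<forall>w. \<rho> w < p) \<longrightarrow> vanish s (slab \<rho>))"
  shows "vanish (p * m * s) A"
  unfolding vanish_def
proof (intro allI impI)
  fix z assume z: "primroot (p * m * s) z"
  \<comment> \<open>The exponents \<open>e\<close> and \<open>f\<close> are complementary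
    idempotents modulo \<open>p * m * s\<close>; they split \<open>z\<close> into its two
    parts.\<close>
  have cop: "coprime (p * m) s" using s by (simp add: m)
  obtain e where e: "[e = 0] (mod p * m)" "[e = 1] (mod s)"
    using binary_chinese_remainder_nat[OF cop] by blast
  obtain f where f: "[f = 1] (mod p * m)" "[f = 0] (mod s)"
    using binary_chinese_remainder_nat[OF cop] by blast
  have ecop: "coprime e s" and fcop: "coprime f (p * m)"
    using e f by (metis cong_imp_coprime cong_sym coprime_1_left)+
  have "[e + f = 1] (mod p * m)" "[e + f = 1] (mod s)"
    using cong_add[OF e(1) f(1)] cong_add[OF e(2) f(2)] by simp_all
  then have "[e + f = 1] (mod p * m * s)" using cop by (rule coprime_cong_mult_nat)
  then have zz: "z ^ (e + f) = z" using primroot_power_eq_iff[OF z, of "e + f" 1] by simp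
  define x where "x = z ^ f"
  define y where "y = z ^ e"
  have zxy: "z ^ a = x ^ a * y ^ a" for a
    using zz by (metis x_def y_def mult.commute power_add power_mult_distrib)
  have y: "primroot s y"
    unfolding primroot_def
  proof (intro conjI allI)
    fix i
    have "y ^ i = 1 \<longleftrightarrow> p * m * s dvd e * i"
      using z by (simp add: y_def primroot_def flip: power_mult)
    also have "\<dots> \<longleftrightarrow> s dvd e * i"
      using e(1) cop by (auto simp: cong_0_iff intro: divides_mult dest: dvd_mult_right)
    also have "\<dots> \<longleftrightarrow> s dvd i"
      using ecop by (simp add: coprime_commute coprime_dvd_mult_right_iff)
    finally show "y ^ i = 1 \<longleftrightarrow> s dvd i" .
  qed (rule s(2))
  have x: "x ^ i = 1 \<longleftrightarrow> p * m dvd i" for i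
  proof -
    have "x ^ i = 1 \<longleftrightarrow> p * m * s dvd f * i"
      using z by (simp add: x_def primroot_def flip: power_mult)
    also have "\<dots> \<longleftrightarrow> p * m dvd f * i"
      using f(2) cop by (auto simp: cong_0_iff intro: divides_mult dest: dvd_mult_left)
    also have "\<dots> \<longleftrightarrow> p * m dvd i"
      using fcop by (simp add: coprime_commute coprime_dvd_mult_right_iff)
    finally show ?thesis .
  qed
  \<comment> \<open>It suffices that the value does not depend on the section. For
    \<open>s = 1\<close> it is the cardinality, fixed by the common complement
    \<open>B\<close>.\<close>
  have "\<exists>c. \<forall>\<rho>. (\<forall>w. \<rho> w < p) \<longrightarrow> ev (slab \<rho>) y = c"
  proof (cases "s = 1")
    case True
    then have y1: "y = 1" using y by (auto simp: primroot_def dest: spec[of _ 1])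
    have "ev (slab \<rho>) y = of_nat (m * L div card B)" if "\<forall>w. \<rho> w < p" for \<rho>
    proof -
      have "card (slab \<rho>) * card B = m * L" using tiles_card[OF tiles_slab] that by blast
      moreover from this have "0 < card B" using m_pos L_pos by (cases "card B") auto
      ultimately show ?thesis unfolding y1 by (metis ev_1 div_mult_self_is_m)
    qed
    then show ?thesis by blast
  next
    case False
    then show ?thesis using van y by (auto simp: vanish_def)
  qed
  then obtain c where c: "\<And>\<rho>. (\<And>w. \<rho> w < p) \<Longrightarrow> ev (slab \<rho>) y = c" by blast
  have xm: "x ^ m \<noteq> 1" using x[of m] m_pos p_gt_1 by (auto dest: dvd_imp_le)
  have "(x ^ m) ^ p = 1" using x[of "m * p"] by (simp add: mult.commute flip: power_mult)
  then have geo: "(\<Sum>j<p. (x ^ m) ^ j) = 0" using xm by (simp add: geometric_sum)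
  have "ev A z = (\<Sum>w<m. \<Sum>j<p. \<Sum>a\<in>layer w j. x ^ a * y ^ a)"
    unfolding ev_def zxy by (rule sum_layers)
  also have "\<dots> = (\<Sum>w<m. \<Sum>j<p. x ^ w * (x ^ m) ^ j * ev (layer w 0) y)"
  proof (intro sum.cong refl)
    fix w j assume wj: "w \<in> {..<m}" "j \<in> {..<p}"
    have "x ^ a = x ^ w * (x ^ m) ^ j" if "a \<in> layer w j" for a
    proof -
      have "x ^ a = x ^ (w + m * j)"
        using that wj x[of "p * m"] layer_bound[of w j]
        by (intro power_cong_root_of_unity[of _ "p * m"]) (auto simp: layer_def cong_def)
      then show ?thesis by (simp add: power_add power_mult)
    qed
    then have "(\<Sum>a\<in>layer w j. x ^ a * y ^ a) = x ^ w * (x ^ m) ^ j * ev (layer w j) y"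
      by (simp add: ev_def sum_distrib_left)
    then show "(\<Sum>a\<in>layer w j. x ^ a * y ^ a) = x ^ w * (x ^ m) ^ j * ev (layer w 0) y"
      using ev_layer_eq[OF c, of w j] wj by simp
  qed
  also have "\<dots> = (\<Sum>w<m. x ^ w * ev (layer w 0) y * (\<Sum>j<p. (x ^ m) ^ j))"
    unfolding sum_distrib_left by (intro sum.cong refl) (simp only: mult_ac)
  also have "\<dots> = 0" unfolding geo by simp
  finally show "ev A z = 0" .
qed

text \<open>\<open>vanish_top\<close> with \<open>s = 1\<close> shows that \<open>A\<close> takes
  the top power of \<open>p\<close>, so for \<open>B\<close> only divisors of \<open>m * L\<close>
  matter. For \<open>A\<close>, a divisor of \<open>m * L\<close> is treated by writing
  \<open>A\<close> as the union of \<open>p\<close> constant slabs, and any other one by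
  \<open>vanish_top\<close>.\<close>

lemma T2_mod_lift:
  assumes IH: "\<And>A' B'. tiles (m * L) A' B' \<Longrightarrow> T2_mod (m * L) A' \<and> T2_mod (m * L) B'"
  shows "T2_mod (p * m * L) A \<and> T2_mod (p * m * L) B"
proof -
  have tB: "T2_mod (m * L) B" using IH[OF tiles_slab[of "\<lambda>_. 0"]] p_pos by blast
  have topA: "vanish (p ^ Suc k) A" using vanish_top[of 1] by (simp add: m)
  have topB: "\<not> vanish (p ^ Suc k) B"
    using tiles_vanish_prime_power(2)[OF t p _ topA] by simp
  have dvd_cases: "s dvd m * L \<or> multiplicity p s = Suc k"
    if s: "s dvd p * m * L" for s
  proof -
    have s0: "0 < s" using that p_pos m_pos L_pos by (metis dvd_0_left_iff mult_eq_0_iff neq0_conv)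
    define i where "i = multiplicity p s"
    obtain u where u: "s = p ^ i * u" "\<not> p dvd u"
      using multiplicity_decompose'[of s p] s0 p unfolding i_def by (metis not_prime_unit not_gr0)
    have up: "coprime u p" using u(2) p by (simp add: coprime_commute prime_imp_coprime)
    then have "coprime u (p * m)" by (simp add: m)
    moreover have "u dvd p * m * L" using u(1) s by (metis dvd_mult_right)
    ultimately have uL: "u dvd L" by (simp add: coprime_dvd_mult_right_iff)
    have "p ^ i dvd p ^ Suc k * L" using s u by (metis dvd_mult_left m power_Suc)
    moreover have "coprime (p ^ i) L" using pL by simp
    ultimately have "p ^ i dvd p ^ Suc k" by (simp only: coprime_dvd_mult_left_iff)
    then have "i \<le> Suc k" using p_gt_1 by (simp only: power_dvd_imp_le)
    moreover have "s dvd m * L" if "i \<le> k"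
      using that uL unfolding u m by (intro mult_dvd_mono le_imp_power_dvd)
    ultimately show ?thesis by (auto simp: i_def le_Suc_eq)
  qed
  have "vanish s A" if s: "s dvd p * m * L" "1 < s" "\<forall>q\<in>prime_factors s. vanish (q ^ multiplicity q s) A" for s
  proof -
    \<comment> \<open>\<open>A\<close> and the slab share the complement \<open>B\<close>, so
      vanishing at prime powers transfers and (T2) of the slab applies.\<close>
    have slabs: "vanish r (slab \<rho>)"
      if r: "r dvd m * L" "1 < r" and \<rho>: "\<And>w. \<rho> w < p"
        and v: "\<And>q. prime q \<Longrightarrow> q dvd r \<Longrightarrow> vanish (q ^ multiplicity q r) A" for r \<rho>
    proof -
      have tS: "tiles (m * L) (slab \<rho>) B" using tiles_slab \<rho> by blast
      show ?thesis
      proof (rule T2_modD[OF conjunct1[OF IH[OF tS]] r])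
        fix q assume q: "prime q" "q dvd r"
        show "vanish (q ^ multiplicity q r) (slab \<rho>)"
        proof (rule tiles_vanish_transfer[OF t tS q(1)])
          show "1 \<le> multiplicity q r" using q r by (intro multiplicity_pos) auto
          show "q ^ multiplicity q r dvd m * L" using r(1) multiplicity_dvd dvd_trans by blast
        qed (use v q in auto)
      qed
    qed
    from dvd_cases[OF s(1)] show ?thesis
    proof
      assume d: "s dvd m * L"
      have sl: "vanish s (slab (\<lambda>_. j))" if "j < p" for j
        using s d that by (intro slabs) (auto simp: in_prime_factors_iff)
      show ?thesis unfolding vanish_def
      proof (intro allI impI)
        fix z assume z: "primroot s z"
        have "ev A z = (\<Sum>w<m. \<Sum>j<p. ev (layer w j) z)"
          unfolding ev_def by (rule sum_layers)
        also have "\<dots> = (\<Sum>j<p. \<Sum>w<m. ev (layer w j) z)" by (rule sum.swap)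
        also have "\<dots> = (\<Sum>j<p. ev (slab (\<lambda>_. j)) z)"
          using ev_slab[of "\<lambda>_. _"] by (intro sum.cong) auto
        also have "\<dots> = 0" using sl z by (simp add: vanish_def)
        finally show "ev A z = 0" .
      qed
    next
      assume i: "multiplicity p s = Suc k"
      obtain u where u: "s = p ^ Suc k * u" "\<not> p dvd u"
        using multiplicity_decompose'[of s p] s p i by (metis not_one_less_zero not_prime_unit)
      have u0: "0 < u" using u s by (cases u) auto
      have pu: "coprime p u" using u(2) p by (simp add: prime_imp_coprime)
      then have "coprime u (p * m)" by (simp add: m coprime_commute)
      moreover have "u dvd p * m * L" using u(1) s by (metis dvd_mult_right)
      ultimately have uL: "u dvd m * L" by (simp add: coprime_dvd_mult_right_iff)
      have "vanish u (slab \<rho>)" if \<rho>: "\<forall>w. \<rho> w < p" and u1: "u \<noteq> 1" for \<rho>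
      proof (rule slabs[OF uL])
        fix q assume q: "prime q" "q dvd u"
        have "q \<noteq> p" using q u by auto
        then have "multiplicity q (p ^ Suc k) = 0"
          using q p by (intro multiplicity_distinct_prime_power) auto
        moreover have "multiplicity q s = multiplicity q (p ^ Suc k) + multiplicity q u"
          unfolding u(1) using q u0 p_pos by (intro prime_elem_multiplicity_mult_distrib) auto
        moreover have "q \<in> prime_factors s"
          using q u0 p_pos unfolding u(1) by (simp add: in_prime_factors_iff del: power_Suc)
        ultimately show "vanish (q ^ multiplicity q u) A" using s(3) by auto
      qed (use u0 u1 \<rho> in auto)
      then have "vanish (p * m * u) A" using pu u0 by (intro vanish_top) auto
      then show ?thesis by (simp add: u m)
    qed
  qed
  moreover have "vanish s B" if s: "s dvd p * m * L" "1 < s" "\<forall>q\<in>prime_factors s. vanish (q ^ multiplicity q s) B" for s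
  proof -
    have "multiplicity p s \<noteq> Suc k"
    proof
      assume i: "multiplicity p s = Suc k"
      then have "p dvd s" by (metis multiplicity_dvd dvd_power dvd_trans zero_less_Suc)
      then have "p \<in> prime_factors s" using p s by (auto simp: in_prime_factors_iff)
      then show False using s topB i by metis
    qed
    then show ?thesis using dvd_cases[OF s(1)] tB s by (auto simp: T2_mod_def)
  qed
  ultimately show ?thesis unfolding T2_mod_def by blast
qed

end

subsection \<open>The splitting of near-coincident representations\<close>

text \<open>The hypotheses force the same exponent \<open>v \<le> k\<close> of \<open>p\<close> in
  \<open>x\<close> and \<open>y\<close>; the quotient of the parts prime to \<open>p\<close> is the
  unit \<open>r\<close>.\<close>

lemma unit_multiple_mod_prime_power:
  fixes x y :: int and p :: nat
  assumes p: "prime p" and xy: "[x = y] (mod int p ^ k)"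
    and x: "\<not> int p ^ Suc k dvd x" and y: "\<not> int p ^ Suc k dvd y"
  shows "\<exists>r. coprime r p \<and> [int r * x = y] (mod int p ^ Suc k)"
proof -
  have ip: "prime (int p)" using p by simp
  then have p0: "int p \<noteq> 0" "\<not> is_unit (int p)" by auto
  have "x \<noteq> 0" using x by auto
  define v where "v = multiplicity (int p) x"
  obtain x' where x': "x = int p ^ v * x'" "\<not> int p dvd x'"
    using multiplicity_decompose'[OF \<open>x \<noteq> 0\<close> p0(2)] unfolding v_def by metis
  have v: "v \<le> k"
  proof (rule ccontr)
    assume "\<not> v \<le> k"
    then have "int p ^ Suc k dvd int p ^ v" by (intro le_imp_power_dvd) simp
    then show False using x x'(1) dvd_trans by (metis dvd_triv_left)
  qed
  have dxy: "int p ^ k dvd x - y" using xy by (simp add: cong_iff_dvd_diff)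
  have "int p ^ v dvd y"
  proof -
    have "int p ^ v dvd x - y" using dvd_trans[OF le_imp_power_dvd[OF v] dxy] .
    moreover have "int p ^ v dvd x" using x' by simp
    ultimately show ?thesis using dvd_diff[of "int p ^ v" x "x - y"] by simp
  qed
  then obtain y' where y': "y = int p ^ v * y'" by blast
  have "\<not> int p dvd y'"
  proof
    assume "int p dvd y'"
    then have d: "int p ^ Suc v dvd y" unfolding y' by (simp add: mult_dvd_mono)
    show False
    proof (cases "v = k")
      case True
      then show False using d y by simp
    next
      case False
      then have "int p ^ Suc v dvd x - y"
        using v by (intro dvd_trans[OF le_imp_power_dvd dxy]) simp
      then have "int p ^ Suc v dvd (x - y) + y" using d by (rule dvd_add)
      then have "int p * int p ^ v dvd x' * int p ^ v" using x' by (simp add: mult.commute)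
      then show False using x'(2) p0 by simp
    qed
  qed
  then have cy: "coprime y' (int p)" using prime_imp_coprime[OF ip] by (simp add: coprime_commute)
  have cx: "coprime x' (int p)" using prime_imp_coprime[OF ip x'(2)] by (simp add: coprime_commute)
  then have "coprime x' (int p ^ Suc k)" by simp
  then obtain c where c: "[x' * c = 1] (mod int p ^ Suc k)" using cong_solve_coprime_int by blast
  have "[x' * c = 1] (mod int p)" using c by (rule cong_dvd_modulus) simp
  then have cc: "coprime c (int p)"
    by (metis cong_imp_coprime cong_sym coprime_1_left coprime_mult_left_iff)
  define r where "r = nat (c * y' mod int p ^ Suc k)"
  have "0 < int p ^ Suc k" using p prime_gt_0_nat by simp
  then have "int r = c * y' mod int p ^ Suc k" unfolding r_def by simp
  then have r: "[int r = c * y'] (mod int p ^ Suc k)" by simp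
  have "[int r = c * y'] (mod int p)" using r by (rule cong_dvd_modulus) simp
  moreover have "coprime (c * y') (int p)" using cc cy by simp
  ultimately have "coprime (int r) (int p)" using cong_imp_coprime cong_sym by blast
  then have "coprime r p" by simp
  moreover have "[int r * x = y] (mod int p ^ Suc k)"
  proof -
    have "[int r * x = c * y' * x] (mod int p ^ Suc k)" using r by (rule cong_scalar_right)
    also have "c * y' * x = (x' * c) * y" unfolding x'(1) y' by (simp add: mult_ac)
    also have "[(x' * c) * y = 1 * y] (mod int p ^ Suc k)" using c by (rule cong_scalar_right)
    finally show ?thesis by simp
  qed
  ultimately show ?thesis by blast
qed

text \<open>If both components differ, the differences \<open>a - a'\<close> and
  \<open>b' - b\<close> are nonzero modulo \<open>p ^ Suc k\<close> but agree modulo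
  \<open>p ^ k\<close>. A unit \<open>r\<close>, equal to 1 modulo \<open>L\<close>, carries the
  first to the second, and then the dilated tiling has two representations of one element.\<close>

lemma tiles_split:
  assumes t: "tiles (p ^ Suc k * L) A B" and p: "prime p" and pL: "coprime p L"
    and ab: "a \<in> A" "a' \<in> A" "b \<in> B" "b' \<in> B" and e: "[a + b = a' + b'] (mod p ^ k * L)"
  shows "[a = a'] (mod p ^ Suc k) \<or> [b = b'] (mod p ^ Suc k)"
proof (rule ccontr)
  assume "\<not> ?thesis"
  then have na: "\<not> [a = a'] (mod p ^ Suc k)" and nb: "\<not> [b = b'] (mod p ^ Suc k)" by auto
  define x y where "x = int a - int a'" and "y = int b' - int b"
  have "\<not> [int a = int a'] (mod int (p ^ Suc k))" "\<not> [int b' = int b] (mod int (p ^ Suc k))"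
    using na nb by (auto simp only: cong_int_iff cong_sym_eq)
  then have xy: "\<not> int p ^ Suc k dvd x" "\<not> int p ^ Suc k dvd y"
    by (simp_all add: x_def y_def cong_iff_dvd_diff)
  have "[a + b = a' + b'] (mod p ^ k)" using e by (rule cong_modulus_mult_nat)
  then have "[int (a + b) = int (a' + b')] (mod int (p ^ k))" by (simp only: cong_int_iff)
  then have "[x = y] (mod int p ^ k)"
    by (simp add: cong_iff_dvd_diff x_def y_def algebra_simps)
  then obtain r0 where r0: "coprime r0 p" "[int r0 * x = y] (mod int p ^ Suc k)"
    using unit_multiple_mod_prime_power[OF p _ xy] by blast
  have "coprime (p ^ Suc k) L" using pL by simp
  then obtain r where r: "[r = r0] (mod p ^ Suc k)" "[r = 1] (mod L)"
    using binary_chinese_remainder_nat by blast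
  have "[r = r0] (mod p)" using r(1) by (rule cong_dvd_modulus_nat) simp
  then have rp: "coprime r p" using r0(1) by (metis cong_imp_coprime cong_sym)
  moreover have "coprime r L" using r(2) by (metis cong_imp_coprime cong_sym coprime_1_left)
  ultimately have "coprime r (p ^ Suc k * L)" by simp
  then have "coprime r (card A)"
    unfolding tiles_card[OF t, symmetric] by simp
  moreover have r_pos: "0 < r" using rp prime_gt_1_nat[OF p] by (cases r) auto
  ultimately have t': "tiles (p ^ Suc k * L) ((*) r ` A) B" by (rule tiles_dilate[OF t])
  have "[int r * x = y] (mod int p ^ Suc k)"
  proof -
    have "[int r = int r0] (mod int (p ^ Suc k))" using r(1) by (simp only: cong_int_iff)
    then have "[int r * x = int r0 * x] (mod int p ^ Suc k)"
      by (intro cong_scalar_right) simp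
    then show ?thesis using r0(2) cong_trans by blast
  qed
  then have "[int (r * a + b) = int (r * a' + b')] (mod int (p ^ Suc k))"
    by (simp add: cong_iff_dvd_diff x_def y_def algebra_simps)
  then have eP: "[r * a + b = r * a' + b'] (mod p ^ Suc k)" by (simp only: cong_int_iff)
  have "[r * c + d = c + d] (mod L)" for c d
    using cong_add[OF cong_scalar_right[OF r(2)] cong_refl] by simp
  moreover have "[a + b = a' + b'] (mod L)" using e by (rule cong_dvd_modulus_nat) simp
  ultimately have "[r * a + b = r * a' + b'] (mod L)"
    using cong_trans cong_sym by metis
  with eP have "[r * a + b = r * a' + b'] (mod p ^ Suc k * L)"
    using pL by (intro coprime_cong_mult_nat) simp_all
  then have "r * a = r * a'" using tiles_inj[OF t'] ab by blast
  then show False using r_pos na by simp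
qed

text \<open>The group ring of the integers modulo \<open>L\<close> over the field with
  \<open>p\<close> elements is reduced: if the square of the mask is 0 modulo \<open>p\<close>, so
  is its \<open>p\<close>-th power, which by Frobenius is the mask of the dilate by
  \<open>p\<close>.\<close>

lemma ev_square_dvd_prime:
  assumes p: "prime p" and pL: "coprime p L" and L: "0 < L" and S: "S \<subseteq> {..<L}"
    and h: "intpoly h" "\<And>z. z ^ L = 1 \<Longrightarrow> ev S z ^ 2 = of_nat p * h z"
  shows "S = {}"
proof (rule ccontr)
  assume "S \<noteq> {}"
  then obtain s0 where s0: "s0 \<in> S" by blast
  have fin: "finite S" using S finite_subset by blast
  obtain h' where h': "intpoly h'" "\<And>z. ev S z ^ p = ev S (z ^ p) + of_nat p * h' z"
    using ev_power_prime[OF p fin] by blast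
  define g where "g = (\<lambda>z. ev S z ^ (p - 2) * h z - h' z)"
  have "intpoly g"
    unfolding g_def using h(1) h'(1) by (intro intpoly_diff intpoly_mult intpoly_power intpoly_ev)
  then obtain c where c: "c \<in> \<int>"
    "(\<Sum>z | z ^ L = 1. g z * inverse z ^ (p * s0)) = of_nat L * c"
    using intpoly_Fourier_coeff L by metis
  have p2: "2 \<le> p" using prime_ge_2_nat[OF p] .
  have eg: "ev S (z ^ p) = of_nat p * g z" if "z ^ L = 1" for z
  proof -
    have "ev S z ^ p = ev S z ^ (p - 2) * ev S z ^ 2" using p2 by (metis le_add_diff_inverse2 power_add)
    then have "ev S z ^ p = ev S z ^ (p - 2) * (of_nat p * h z)" using h(2)[OF that] by simp
    then have "ev S (z ^ p) = ev S z ^ (p - 2) * (of_nat p * h z) - of_nat p * h' z"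
      using h'(2)[of z] by (simp add: eq_diff_eq)
    then show ?thesis by (simp add: g_def right_diff_distrib mult.left_commute)
  qed
  \<comment> \<open>Multiplication by \<open>p\<close> is injective modulo \<open>L\<close>, so the
    coefficient at \<open>p * s0\<close> is exactly 1 and cannot be divisible by
    \<open>p\<close>.\<close>
  have "{s\<in>S. [p * s = p * s0] (mod L)} = {s0}"
    using S s0 pL by (auto simp: cong_mult_lcancel_nat coprime_commute intro: cong_less_modulus_unique_nat)
  then have "of_nat L = (of_nat L * of_nat (card {s\<in>S. [p * s = p * s0] (mod L)}) :: complex)" by simp
  also have "\<dots> = (\<Sum>z | z ^ L = 1. (\<Sum>s\<in>S. z ^ (p * s)) * inverse z ^ (p * s0))"
    using L fin by (rule count_Fourier_inversion)
  also have "\<dots> = (\<Sum>z | z ^ L = 1. of_nat p * (g z * inverse z ^ (p * s0)))"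
  proof (rule sum.cong)
    fix z assume "z \<in> {z::complex. z ^ L = 1}"
    then have "(\<Sum>s\<in>S. z ^ (p * s)) = of_nat p * g z"
      using eg[of z] by (simp add: ev_def power_mult)
    then show "(\<Sum>s\<in>S. z ^ (p * s)) * inverse z ^ (p * s0) = of_nat p * (g z * inverse z ^ (p * s0))"
      by (simp only: mult.assoc)
  qed simp
  also have "\<dots> = of_nat p * (of_nat L * c)" unfolding sum_distrib_left[symmetric] c(2) by (rule refl)
  finally have "of_nat L * (of_nat p * c) = of_nat L * 1"
    by (metis mult.left_commute mult.right_neutral)
  then have e: "of_nat p * c = 1" using L by simp
  obtain c' where "c = of_int c'" using c(1) Ints_cases by blast
  with e have "of_int (int p * c') = (of_int 1 :: complex)" by simp
  then have "int p * c' = 1" by (simp only: of_int_eq_iff)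
  then have "int p dvd 1" by (metis dvd_triv_left)
  then show False using p2 by simp
qed

section \<open>Classes modulo \<open>m * L\<close> in which one component is frozen modulo
  \<open>p * m\<close>\<close>

lemma sum_mod_lessThan_mult:
  fixes g :: "nat \<Rightarrow> 'a :: comm_semiring_1"
  shows "(\<Sum>u<p * m. g (u mod m)) = of_nat p * (\<Sum>d<m. g d)"
proof -
  have "(\<Sum>u\<in>{k * m..<k * m + m}. g (u mod m)) = (\<Sum>d<m. g d)" for k
    by (subst sum.atLeastLessThan_shift_0) (auto simp: lessThan_atLeast0 intro!: sum.cong)
  then have "(\<Sum>k<p. \<Sum>u\<in>{k * m..<k * m + m}. g (u mod m)) = of_nat p * (\<Sum>d<m. g d)" by simp
  then show ?thesis by (simp add: sum.nat_group)
qed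

text \<open>A class modulo \<open>m * L\<close> is encoded as the pair of \<open>W\<close> modulo
  \<open>m\<close> and \<open>y\<close> modulo \<open>L\<close>. For fixed \<open>W\<close> the set
  collects those \<open>y\<close> whose class freezes the first component at
  \<open>u\<close>.\<close>

definition rigid :: "nat \<Rightarrow> nat \<Rightarrow> nat \<Rightarrow> nat set \<Rightarrow> nat set \<Rightarrow> nat \<Rightarrow> nat \<Rightarrow> nat set" where
  "rigid P m L A B u W = {y. y < L \<and>
    (\<forall>a\<in>A. \<forall>b\<in>B. [a + b = W] (mod m) \<longrightarrow> [a + b = y] (mod L) \<longrightarrow> [a = u] (mod P))}"

text \<open>Isolates the consequence of \<open>tiles_split\<close> in a form symmetric in the tiles,
  so that facts about \<open>RA\<close> yield those about \<open>RB\<close> by interpretation with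
  the tiles exchanged.\<close>

locale split_tiling =
  fixes p m L :: nat and A B :: "nat set"
  assumes p: "prime p" and PL: "coprime (p * m) L"
    and t: "tiles (p * m * L) A B"
    and split: "\<And>a a' b b'. a \<in> A \<Longrightarrow> a' \<in> A \<Longrightarrow> b \<in> B \<Longrightarrow> b' \<in> B \<Longrightarrow>
      [a + b = a' + b'] (mod m * L) \<Longrightarrow> [a = a'] (mod p * m) \<or> [b = b'] (mod p * m)"
begin

lemma swap: "split_tiling p m L B A"
  using p PL tiles_sym[OF t] split by unfold_locales (simp, simp, simp, metis add.commute)

abbreviation "RA u W \<equiv> rigid (p * m) m L A B u W"
abbreviation "RB x W \<equiv> rigid (p * m) m L B A x W"
abbreviation "sliceA u \<equiv> {a\<in>A. [a = u] (mod p * m)}"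
abbreviation "sliceB x \<equiv> {b\<in>B. [b = x] (mod p * m)}"

lemma m_pos: "0 < m" and L_pos: "0 < L" and finA: "finite A" and finB: "finite B"
  using t by (auto simp: tiles_def)

lemma p_gt_1: "1 < p" using p prime_gt_1_nat by blast

lemma mL: "coprime m L" using PL by simp

lemma cong_P_m: "[x = y] (mod p * m) \<Longrightarrow> [x = y] (mod m)" for x y :: nat
  by (erule cong_dvd_modulus_nat) simp

lemma representation:
  obtains a b where "a \<in> A" "b \<in> B" "[a + b = w] (mod p * m)" "[a + b = y] (mod L)"
proof -
  obtain v where v: "[v = w] (mod p * m)" "[v = y] (mod L)"
    using binary_chinese_remainder_nat[OF PL] by blast
  obtain a b where ab: "a \<in> A" "b \<in> B" "[a + b = v] (mod p * m * L)"
    using tiles_surj[OF t] .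
  have "[a + b = v] (mod p * m)" using ab(3) by (rule cong_modulus_mult_nat)
  moreover have "[a + b = v] (mod L)" using ab(3) by (rule cong_dvd_modulus_nat) simp
  ultimately show thesis using that ab v cong_trans by blast
qed

lemma split_class:
  assumes "a \<in> A" "a' \<in> A" "b \<in> B" "b' \<in> B"
    "[a + b = W] (mod m)" "[a + b = y] (mod L)" "[a' + b' = W] (mod m)" "[a' + b' = y] (mod L)"
  shows "[a = a'] (mod p * m) \<or> [b = b'] (mod p * m)"
proof -
  have "[a + b = a' + b'] (mod m)" "[a + b = a' + b'] (mod L)"
    using assms cong_trans cong_sym by blast+
  then have "[a + b = a' + b'] (mod m * L)" using mL by (rule coprime_cong_mult_nat)
  then show ?thesis using split assms by blast
qed

lemma slice_inj:
  assumes "a \<in> A" "a' \<in> A" "b \<in> B" "b' \<in> B"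
    "[a = a'] (mod p * m)" "[b = b'] (mod p * m)" "[a + b = a' + b'] (mod L)"
  shows "a = a' \<and> b = b'"
proof -
  have "[a + b = a' + b'] (mod p * m * L)"
    using cong_add[OF assms(5,6)] assms(7) PL by (rule coprime_cong_mult_nat)
  then show ?thesis using tiles_inj[OF t] assms by blast
qed

text \<open>Once the \<open>A\<close>-component is frozen, the \<open>B\<close>-component must run
  through every lift \<open>x\<close> modulo \<open>p * m\<close> compatible with
  \<open>W\<close>.\<close>

lemma RA_representation:
  assumes y: "y \<in> RA u W" and W: "[u + x = W] (mod m)"
  obtains a b where "a \<in> sliceA u" "b \<in> sliceB x" "[a + b = y] (mod L)" "[a + b = W] (mod m)"
proof -
  obtain a b where ab: "a \<in> A" "b \<in> B" "[a + b = u + x] (mod p * m)" "[a + b = y] (mod L)"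
    using representation .
  have abW: "[a + b = W] (mod m)" using cong_P_m[OF ab(3)] W cong_trans by blast
  then have au: "[a = u] (mod p * m)" using y ab by (simp add: rigid_def)
  then have "[a + b = a + x] (mod p * m)"
    using ab(3) by (metis cong_add_rcancel_nat cong_trans cong_sym)
  then have "[b = x] (mod p * m)" by (simp only: cong_add_lcancel_nat)
  then show thesis using that ab abW au by blast
qed

lemma complement_residue: "\<exists>x. [u + x = W] (mod m)"
proof -
  have "u + (W + (m - 1) * u) = W + m * u" using m_pos by (cases m) auto
  then have "[u + (W + (m - 1) * u) = W] (mod m)" by (simp only: cong_def mod_mult_self2)
  then show ?thesis ..
qed

text \<open>A frozen \<open>A\<close>-component makes the \<open>B\<close>-component take both
  values \<open>x1\<close> and \<open>x1 + m\<close>, which differ modulo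
  \<open>p * m\<close>.\<close>

lemma RA_RB_disjoint:
  assumes "y \<in> RA u W" "y \<in> RB x W"
  shows False
proof -
  obtain x1 where x1: "[u + x1 = W] (mod m)" using complement_residue by blast
  have "[u + (x1 + m) = W] (mod m)" using x1 by (simp add: cong_def flip: add.assoc)
  have *: "[x2 = x] (mod p * m)" if x2: "[u + x2 = W] (mod m)" for x2
  proof -
    obtain a b where "a \<in> sliceA u" "b \<in> sliceB x2" "[a + b = y] (mod L)" "[a + b = W] (mod m)"
      using RA_representation[OF assms(1) x2] .
    then have "[b = x] (mod p * m)" "[b = x2] (mod p * m)"
      using assms(2) by (auto simp: rigid_def add.commute)
    then show ?thesis using cong_trans cong_sym by blast
  qed
  have "[x1 + m = x1 + 0] (mod p * m)"
    using *[OF x1] *[of "x1 + m"] x1 cong_trans cong_sym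
    by (metis add.right_neutral \<open>[u + (x1 + m) = W] (mod m)\<close>)
  then have "[m = 0] (mod p * m)" by (simp only: cong_add_lcancel_nat)
  then have "p * m dvd m" by (simp add: cong_0_iff)
  then show False using p_gt_1 m_pos by (auto dest: dvd_imp_le)
qed

lemma RA_unique:
  assumes "y \<in> RA u W" "y \<in> RA u' W"
  shows "[u = u'] (mod p * m)"
proof -
  obtain a b where ab: "a \<in> A" "b \<in> B" "[a + b = W] (mod p * m)" "[a + b = y] (mod L)"
    using representation .
  then have "[a = u] (mod p * m)" "[a = u'] (mod p * m)"
    using assms cong_P_m by (auto simp: rigid_def)
  then show ?thesis using cong_trans cong_sym by blast
qed

text \<open>Pairs of which any two share a coordinate all share the same one. If \<open>a1\<close>
  and \<open>a0\<close> differ, then \<open>b1\<close> and \<open>b0\<close> agree; a pair with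
  another \<open>B\<close>-residue would have to match both \<open>a0\<close> and
  \<open>a1\<close>.\<close>

lemma RA_RB_cover:
  assumes y: "y < L"
  shows "(\<exists>u<p * m. y \<in> RA u W) \<or> (\<exists>x<p * m. y \<in> RB x W)"
proof -
  have P: "0 < p * m" using p_gt_1 m_pos by simp
  obtain a0 b0 where 0: "a0 \<in> A" "b0 \<in> B" "[a0 + b0 = W] (mod p * m)" "[a0 + b0 = y] (mod L)"
    using representation .
  have W0: "[a0 + b0 = W] (mod m)" using cong_P_m 0 by blast
  show ?thesis
  proof (cases "\<forall>a\<in>A. \<forall>b\<in>B. [a + b = W] (mod m) \<longrightarrow> [a + b = y] (mod L) \<longrightarrow> [a = a0] (mod p * m)")
    case True
    then have "y \<in> RA (a0 mod (p * m)) W" using y by (simp add: rigid_def)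
    then show ?thesis using P mod_less_divisor by blast
  next
    case False
    then obtain a1 b1 where 1: "a1 \<in> A" "b1 \<in> B" "[a1 + b1 = W] (mod m)" "[a1 + b1 = y] (mod L)"
      "\<not> [a1 = a0] (mod p * m)" by blast
    have 10: "[b1 = b0] (mod p * m)" using split_class[of a1 a0 b1 b0] 0 1 W0 by blast
    have "[b = b0] (mod p * m)"
      if "a \<in> A" "b \<in> B" "[a + b = W] (mod m)" "[a + b = y] (mod L)" for a b
    proof (rule ccontr)
      assume nb: "\<not> [b = b0] (mod p * m)"
      then have "[a = a0] (mod p * m)" using split_class[of a a0 b b0] that 0 W0 by blast
      moreover have "[a = a1] (mod p * m)"
        using split_class[of a a1 b b1] that 1 nb 10 cong_trans by blast
      ultimately show False using 1(5) cong_trans cong_sym by blast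
    qed
    then have "y \<in> RB (b0 mod (p * m)) W" using y by (simp add: rigid_def add.commute)
    then show ?thesis using P mod_less_divisor by blast
  qed
qed

text \<open>Within two slices the sums are distinct modulo \<open>L\<close>, and they fill exactly
  the classes frozen at \<open>u\<close> or at \<open>x\<close>. The product thus becomes a function
  of \<open>u\<close> plus a function of \<open>x\<close>.\<close>

lemma ev_slice_mult:
  assumes z: "z ^ L = 1" and W: "[u + x = W] (mod m)"
  shows "ev (sliceA u) z * ev (sliceB x) z = ev (RA u W) z + ev (RB x W) z"
proof -
  interpret sw: split_tiling p m L B A by (rule swap)
  let ?f = "\<lambda>(a, b). (a + b) mod L"
  have sub: "?f ab \<in> RA u W \<union> RB x W" if ab: "ab \<in> sliceA u \<times> sliceB x" for ab
  proof -
    obtain a b where ab: "ab = (a, b)" "a \<in> A" "b \<in> B" "[a = u] (mod p * m)" "[b = x] (mod p * m)"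
      using ab by auto
    have abW: "[a + b = W] (mod m)"
      using cong_P_m[OF cong_add[OF ab(4,5)]] W cong_trans by blast
    have "(a + b) mod L < L" using L_pos by simp
    from RA_RB_cover[OF this, of W] show ?thesis
    proof (elim disjE exE conjE)
      fix u' assume u': "(a + b) mod L \<in> RA u' W"
      then have "[a = u'] (mod p * m)" using ab abW by (simp add: rigid_def)
      then have "[u' = u] (mod p * m)" using ab(4) cong_trans cong_sym by blast
      then have "(a + b) mod L \<in> RA u W"
        using u' unfolding rigid_def by (auto intro: cong_trans)
      then show ?thesis using ab by simp
    next
      fix x' assume x': "(a + b) mod L \<in> RB x' W"
      then have "[b = x'] (mod p * m)" using ab abW by (simp add: rigid_def add.commute)
      then have "[x' = x] (mod p * m)" using ab(5) cong_trans cong_sym by blast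
      then have "(a + b) mod L \<in> RB x W"
        using x' unfolding rigid_def by (auto intro: cong_trans)
      then show ?thesis using ab by simp
    qed
  qed
  have sup: "y \<in> ?f ` (sliceA u \<times> sliceB x)" if y: "y \<in> RA u W \<union> RB x W" for y
  proof -
    have "\<exists>a b. a \<in> sliceA u \<and> b \<in> sliceB x \<and> [a + b = y] (mod L)"
    proof (cases "y \<in> RA u W")
      case True
      then show ?thesis using RA_representation[OF True W] by blast
    next
      case False
      then have "y \<in> RB x W" using y by blast
      moreover have "[x + u = W] (mod m)" using W by (simp add: add.commute)
      ultimately obtain b a where "b \<in> sliceB x" "a \<in> sliceA u" "[b + a = y] (mod L)"
        using sw.RA_representation[of y x W u] by blast
      then have "a \<in> sliceA u \<and> b \<in> sliceB x \<and> [a + b = y] (mod L)" by (simp add: add.commute)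
      then show ?thesis by blast
    qed
    then obtain a b where ab: "a \<in> sliceA u" "b \<in> sliceB x" "[a + b = y] (mod L)" by blast
    moreover have "y < L" using y by (auto simp: rigid_def)
    ultimately have "?f (a, b) = y" by (simp add: cong_def)
    then show ?thesis using ab by (intro image_eqI[of _ _ "(a, b)"]) auto
  qed
  have inj: "inj_on ?f (sliceA u \<times> sliceB x)"
  proof (rule inj_onI)
    fix ab ab' assume "ab \<in> sliceA u \<times> sliceB x" "ab' \<in> sliceA u \<times> sliceB x" and e: "?f ab = ?f ab'"
    then obtain a b a' b' where *: "ab = (a, b)" "ab' = (a', b')" "a \<in> sliceA u" "b \<in> sliceB x"
      "a' \<in> sliceA u" "b' \<in> sliceB x" by blast
    then have "[a = a'] (mod p * m)" "[b = b'] (mod p * m)" using cong_trans cong_sym by blast+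
    then show "ab = ab'" using slice_inj[of a a' b b'] * e by (auto simp: cong_def)
  qed
  have bij: "bij_betw ?f (sliceA u \<times> sliceB x) (RA u W \<union> RB x W)"
    unfolding bij_betw_def using inj sub sup by blast
  have "ev (sliceA u) z * ev (sliceB x) z = (\<Sum>ab\<in>sliceA u \<times> sliceB x. z ^ ?f ab)"
    unfolding ev_mult using z
    by (intro sum.cong) (auto intro!: power_cong_root_of_unity simp: cong_def)
  also have "\<dots> = (\<Sum>y\<in>RA u W \<union> RB x W. z ^ y)" by (rule sum.reindex_bij_betw[OF bij])
  also have "\<dots> = ev (RA u W) z + ev (RB x W) z"
    unfolding ev_def using RA_RB_disjoint by (intro sum.union_disjoint) (auto simp: rigid_def)
  finally show ?thesis .
qed

text \<open>By \<open>ev_slice_mult\<close>, the first factor is a multiple of a difference of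
  \<open>A\<close>-slices and the second of a difference of \<open>B\<close>-slices. The product of
  those differences is a mixed second difference of a function of \<open>u\<close> plus a function
  of \<open>x\<close>, hence 0.\<close>

lemma ev_rigid_annihilate:
  assumes z: "z ^ L = 1" and u: "[u = u'] (mod m)" and x: "[x = x'] (mod m)"
  shows "(ev (RA u W1) z - ev (RA u' W1) z) * (ev (RB x W2) z - ev (RB x' W2) z) = 0"
proof -
  obtain x1 where x1: "[u + x1 = W1] (mod m)" using complement_residue by blast
  obtain u1 where u1': "[x + u1 = W2] (mod m)" using complement_residue by blast
  have x1': "[u' + x1 = W1] (mod m)"
    using x1 u by (metis cong_add_rcancel_nat cong_trans cong_sym)
  have u1: "[u1 + x = W2] (mod m)" "[u1 + x' = W2] (mod m)"
    using u1' x by (metis add.commute cong_add_lcancel_nat cong_trans cong_sym)+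
  have "ev (RA u W1) z - ev (RA u' W1) z = (ev (sliceA u) z - ev (sliceA u') z) * ev (sliceB x1) z"
    using ev_slice_mult[OF z x1] ev_slice_mult[OF z x1'] by (simp add: left_diff_distrib)
  moreover have "ev (RB x W2) z - ev (RB x' W2) z = ev (sliceA u1) z * (ev (sliceB x) z - ev (sliceB x') z)"
    using ev_slice_mult[OF z u1(1)] ev_slice_mult[OF z u1(2)] by (simp add: right_diff_distrib)
  moreover have "(ev (sliceA u) z - ev (sliceA u') z) * (ev (sliceB x) z - ev (sliceB x') z) = 0"
  proof -
    let ?W = "u + x"
    have c: "[u + x' = ?W] (mod m)" "[u' + x = ?W] (mod m)" "[u' + x' = ?W] (mod m)"
      using u x cong_add cong_sym cong_refl by blast+
    have "(ev (sliceA u) z - ev (sliceA u') z) * (ev (sliceB x) z - ev (sliceB x') z)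
        = ev (sliceA u) z * ev (sliceB x) z - ev (sliceA u) z * ev (sliceB x') z
          - (ev (sliceA u') z * ev (sliceB x) z - ev (sliceA u') z * ev (sliceB x') z)"
      by (simp add: left_diff_distrib right_diff_distrib)
    also have "\<dots> = 0"
      unfolding ev_slice_mult[OF z cong_refl[of ?W]] ev_slice_mult[OF z c(1)] ev_slice_mult[OF z c(2)]
        ev_slice_mult[OF z c(3)] by simp
    finally show ?thesis .
  qed
  ultimately show ?thesis by auto
qed

text \<open>The number of ways to write a residue as an element of \<open>RA u W1\<close> plus an element of
  \<open>RB x W2\<close> is a function of \<open>u\<close> plus a function of \<open>x\<close>. So if it is positive somewhere, it is
  positive on a whole row or column, which makes one of the two sets have at least \<open>p\<close> elements.\<close>

lemma full_full:
  assumes fA: "\<And>u. [u = u0] (mod m) \<Longrightarrow> RA u W1 \<noteq> {}" and fB: "\<And>x. [x = x0] (mod m) \<Longrightarrow> RB x W2 \<noteq> {}"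
  shows "p ^ 2 \<le> L"
proof -
  interpret sw: split_tiling p m L B A by (rule swap)
  define F where "F j = RA (u0 + j * m) W1" for j
  define G where "G j = RB (x0 + j * m) W2" for j
  define n where "n y j k = card {i\<in>F j \<times> G k. [fst i + snd i = y] (mod L)}" for y j k
  have cm: "[c + j * m = c] (mod m)" for c j by (simp add: cong_def)
  have ne: "F j \<noteq> {}" "G j \<noteq> {}" for j using fA fB cm by (auto simp: F_def G_def)
  have fin: "finite (F j)" "finite (G j)" and sub: "F j \<subseteq> {..<L}" "G j \<subseteq> {..<L}" for j
    by (auto simp: F_def G_def rigid_def)
  have index: "j = k" if "j < p" "k < p" "[c + j * m = c + k * m] (mod p * m)" for j k c
  proof -
    have "[j * m = k * m] (mod p * m)" using that(3) by (simp only: cong_add_lcancel_nat)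
    then have "j * m = k * m" using that m_pos by (intro cong_less_modulus_unique_nat[of _ _ "p * m"]) auto
    then show ?thesis using m_pos by simp
  qed
  have disjF: "j = k" if "j < p" "k < p" "y \<in> F j" "y \<in> F k" for j k y
    using that RA_unique unfolding F_def by (intro index) auto
  have disjG: "j = k" if "j < p" "k < p" "y \<in> G j" "y \<in> G k" for j k y
    using that sw.RA_unique unfolding G_def by (intro index) auto
  have add: "n y j k + n y j' k' = n y j k' + n y j' k" for y j k j' k'
  proof -
    let ?S = "\<lambda>j k. (\<Sum>z | z ^ L = 1. ev (F j) z * ev (G k) z * inverse z ^ y)"
    have inv: "of_nat L * of_nat (n y j k) = ?S j k" for j k
    proof -
      have "of_nat L * of_nat (n y j k)
          = (\<Sum>z | z ^ L = (1::complex). (\<Sum>i\<in>F j \<times> G k. z ^ (fst i + snd i)) * inverse z ^ y)"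
        unfolding n_def using L_pos fin by (intro count_Fourier_inversion) auto
      also have "\<dots> = ?S j k" by (simp add: ev_mult case_prod_unfold)
      finally show ?thesis .
    qed
    have "?S j k + ?S j' k' = ?S j k' + ?S j' k"
      unfolding sum.distrib[symmetric]
    proof (rule sum.cong)
      fix z assume "z \<in> {z::complex. z ^ L = 1}"
      then have "(ev (F j) z - ev (F j') z) * (ev (G k) z - ev (G k') z) = 0"
        unfolding F_def G_def using cm cong_trans cong_sym
        by (intro ev_rigid_annihilate) blast+
      then have "ev (F j) z * ev (G k) z + ev (F j') z * ev (G k') z
          = ev (F j) z * ev (G k') z + ev (F j') z * ev (G k) z"
        by (simp add: algebra_simps)
      then show "ev (F j) z * ev (G k) z * inverse z ^ y + ev (F j') z * ev (G k') z * inverse z ^ y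
          = ev (F j) z * ev (G k') z * inverse z ^ y + ev (F j') z * ev (G k) z * inverse z ^ y"
        by (simp only: ring_distribs[symmetric])
    qed simp
    then have "of_nat (L * (n y j k + n y j' k')) = (of_nat (L * (n y j k' + n y j' k)) :: complex)"
      unfolding inv[symmetric] by (simp add: ring_distribs)
    then have "L * (n y j k + n y j' k') = L * (n y j k' + n y j' k)" by (simp only: of_nat_eq_iff)
    then show ?thesis using L_pos by simp
  qed
  have n_pos: "0 < n y j k \<longleftrightarrow> (\<exists>s\<in>F j. \<exists>r\<in>G k. [s + r = y] (mod L))" for y j k
    unfolding n_def using fin by (auto simp: card_gt_0_iff)
  \<comment> \<open>For each \<open>j < p\<close> the residue \<open>y\<close> is a sum from
    \<open>H j\<close> and \<open>Y\<close>. The \<open>H j\<close> are disjoint, so the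
    \<open>p\<close> summands in \<open>Y\<close> are distinct.\<close>
  have big: "p \<le> card Y"
    if "\<And>j. j < p \<Longrightarrow> \<exists>s\<in>H j. \<exists>r\<in>Y. [s + r = y] (mod L)" "finite Y" "\<And>j. H j \<subseteq> {..<L}"
      "\<And>i j s. i < p \<Longrightarrow> j < p \<Longrightarrow> s \<in> H i \<Longrightarrow> s \<in> H j \<Longrightarrow> i = j" for H Y y
  proof -
    have "\<forall>j. \<exists>s r. j < p \<longrightarrow> s \<in> H j \<and> r \<in> Y \<and> [s + r = y] (mod L)"
      using that(1) by blast
    then obtain s r where sr: "\<And>j. j < p \<Longrightarrow> s j \<in> H j \<and> r j \<in> Y \<and> [s j + r j = y] (mod L)"
      by metis
    have "inj_on r {..<p}"
    proof (rule inj_onI)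
      fix i j assume ij: "i \<in> {..<p}" "j \<in> {..<p}" "r i = r j"
      then have "[s i + r i = s j + r i] (mod L)" using sr cong_trans cong_sym by (metis lessThan_iff)
      then have "[s i = s j] (mod L)" by (simp only: cong_add_rcancel_nat)
      moreover have "s i < L" "s j < L" using sr that(3) ij by blast+
      ultimately have "s i = s j" using cong_less_modulus_unique_nat by blast
      then show "i = j" using that(4) sr ij by (metis lessThan_iff)
    qed
    then have "card (r ` {..<p}) = p" by (simp add: card_image)
    moreover have "r ` {..<p} \<subseteq> Y" using sr by auto
    ultimately show ?thesis using card_mono[OF that(2)] by metis
  qed
  have large: "p \<le> card (F j) \<or> p \<le> card (G k)" if jk: "j < p" "k < p" for j k
  proof -
    obtain s r where sr: "s \<in> F j" "r \<in> G k" using ne by blast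
    let ?y = "s + r"
    have pos: "0 < n ?y j k" using n_pos sr cong_refl by blast
    \<comment> \<open>Zeros at \<open>(i, k)\<close> and at \<open>(j, i')\<close> would force
      \<open>n ?y j k = 0\<close> by additivity.\<close>
    have "(\<forall>i. 0 < n ?y i k) \<or> (\<forall>i. 0 < n ?y j i)"
    proof (rule ccontr)
      assume "\<not> ?thesis"
      then obtain i i' where "n ?y i k = 0" "n ?y j i' = 0" by blast
      then show False using add[of ?y j k i i'] pos by simp
    qed
    then show ?thesis
    proof
      assume "\<forall>i. 0 < n ?y i k"
      then have "p \<le> card (G k)"
        unfolding n_pos using fin sub disjF by (intro big[of F _ ?y]) auto
      then show ?thesis ..
    next
      assume a: "\<forall>i. 0 < n ?y j i"
      have "p \<le> card (F j)"
      proof (rule big[of G _ ?y])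
        fix i
        show "\<exists>s\<in>G i. \<exists>r\<in>F j. [s + r = ?y] (mod L)"
          using a unfolding n_pos by (metis add.commute)
      qed (use fin sub disjG in auto)
      then show ?thesis ..
    qed
  qed
  have total: "p ^ 2 \<le> L"
    if "\<And>j. j < p \<Longrightarrow> p \<le> card (H j)" "\<And>j. H j \<subseteq> {..<L}"
      "\<And>i j s. i < p \<Longrightarrow> j < p \<Longrightarrow> s \<in> H i \<Longrightarrow> s \<in> H j \<Longrightarrow> i = j" for H
  proof -
    have "p ^ 2 = (\<Sum>j<p. p)" by (simp add: power2_eq_square)
    also have "\<dots> \<le> (\<Sum>j<p. card (H j))" using that(1) by (intro sum_mono) auto
    also have "\<dots> = card (\<Union>j\<in>{..<p}. H j)"
      using that(2,3) finite_subset by (intro card_UN_disjoint[symmetric]) blast+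
    also have "\<dots> \<le> card {..<L}" using that(2) by (intro card_mono) auto
    finally show ?thesis by simp
  qed
  \<comment> \<open>If one \<open>F j\<close> has fewer than \<open>p\<close> elements, every
    \<open>G k\<close> has at least \<open>p\<close>; either way \<open>p\<close> disjoint large
    sets fit into \<open>{..<L}\<close>.\<close>
  show ?thesis
  proof (cases "\<forall>j<p. p \<le> card (F j)")
    case True
    then show ?thesis using total[of F] sub disjF by blast
  next
    case False
    then have "\<forall>k<p. p \<le> card (G k)" using large by blast
    then show ?thesis using total[of G] sub disjG by blast
  qed
qed

text \<open>Modulo \<open>p\<close>, the union \<open>S\<close> of the sets \<open>RA u W\<close> has square zero in the group ring of
  \<open>\<int>/L\<close>, which is reduced because \<open>p\<close> does not divide \<open>L\<close>.\<close>

lemma not_full_imp_empty: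
  assumes nf: "\<And>x W. \<exists>x'. [x' = x] (mod m) \<and> RB x' W = {}" and ne: "RB x1 W1 \<noteq> {}"
  shows "RA u W = {}"
proof -
  interpret sw: split_tiling p m L B A by (rule swap)
  \<comment> \<open>The term of an empty \<open>RB x' V\<close> drops out of
    \<open>ev_rigid_annihilate\<close>, so after multiplication by the mask of \<open>RB x V\<close>
    only \<open>u mod m\<close> matters.\<close>
  have ann: "ev (RB x V) z * ev (RA u W) z = ev (RB x V) z * ev (RA (u mod m) W) z"
    if z: "z ^ L = 1" for x V u z
  proof -
    obtain x' where x': "[x' = x] (mod m)" "RB x' V = {}" using nf by blast
    have "(ev (RA u W) z - ev (RA (u mod m) W) z) * (ev (RB x V) z - ev (RB x' V) z) = 0"
      using z x'(1) by (intro ev_rigid_annihilate) (auto simp: cong_sym_eq)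
    then show ?thesis using x'(2) by (auto simp: algebra_simps)
  qed
  have finR: "finite (RB x V)" "finite (RA x V)" for x V by (auto simp: rigid_def)
  \<comment> \<open>At \<open>z = 1\<close> the nonempty \<open>RB x1 W1\<close> contributes a
    nonzero factor that cancels. It follows that \<open>p\<close> divides
    \<open>card S\<close>.\<close>
  have card_eq: "card (RA u W) = card (RA (u mod m) W)" for u
  proof -
    have "card (RB x1 W1) \<noteq> 0" using ne finR by simp
    then show ?thesis using ann[of 1 x1 W1 u] by simp
  qed
  define S where "S = (\<Union>u\<in>{..<p * m}. RA u W)"
  define R where "R = (\<Union>x\<in>{..<p * m}. RB x W)"
  have "S \<subseteq> {..<L}" "R \<subseteq> {..<L}" by (auto simp: S_def R_def rigid_def)
  have "S \<union> R = {..<L}"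
    using \<open>S \<subseteq> _\<close> \<open>R \<subseteq> _\<close> RA_RB_cover[of _ W] by (fastforce simp: S_def R_def)
  moreover have "S \<inter> R = {}" using RA_RB_disjoint by (auto simp: S_def R_def)
  ultimately have SR: "ev S z + ev R z = ev {..<L} z" for z
    unfolding ev_def using \<open>S \<subseteq> _\<close> \<open>R \<subseteq> _\<close> finite_subset
    by (metis finite_lessThan sum.union_disjoint)
  have evS: "ev S z = (\<Sum>u<p * m. ev (RA u W) z)" for z
    unfolding S_def ev_def using finR RA_unique
    by (intro sum.UNION_disjoint) (auto, metis cong_less_modulus_unique_nat)
  have evR: "ev R z = (\<Sum>x<p * m. ev (RB x W) z)" for z
    unfolding R_def ev_def using finR sw.RA_unique
    by (intro sum.UNION_disjoint) (auto, metis cong_less_modulus_unique_nat)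
  define c where "c = (\<Sum>d<m. card (RA d W))"
  have cardS: "of_nat (card S) = (of_nat p * of_nat c :: complex)"
  proof -
    have "(of_nat (card S) :: complex) = (\<Sum>u<p * m. of_nat (card (RA u W)))"
      using evS[of 1] by simp
    also have "\<dots> = (\<Sum>u<p * m. of_nat (card (RA (u mod m) W)))" using card_eq by simp
    also have "\<dots> = of_nat p * of_nat c"
      by (simp add: sum_mod_lessThan_mult[of "\<lambda>d. of_nat (card (RA d W))"] c_def)
    finally show ?thesis .
  qed
  define g where "g z = (\<Sum>x<p * m. \<Sum>d<m. ev (RB x W) z * ev (RA d W) z)" for z
  have RS: "ev R z * ev S z = of_nat p * g z" if z: "z ^ L = 1" for z
  proof -
    have "ev R z * ev S z = (\<Sum>x<p * m. \<Sum>u<p * m. ev (RB x W) z * ev (RA (u mod m) W) z)"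
      unfolding evS evR sum_product by (intro sum.cong refl ann[OF z])
    also have "\<dots> = of_nat p * g z"
      unfolding g_def sum_mod_lessThan_mult[of "\<lambda>d. ev (RB _ W) z * ev (RA d W) z"]
      by (rule sum_distrib_left[symmetric])
    finally show ?thesis .
  qed
  \<comment> \<open>\<open>S\<close> and \<open>R\<close> partition \<open>{..<L}\<close>, so the
    square of \<open>S\<close> is \<open>S\<close> times the full mask minus \<open>R\<close> times
    \<open>S\<close>. At \<open>L\<close>-th roots of unity both terms are \<open>p\<close> times an
    integer polynomial.\<close>
  define h where "h z = of_nat c * ev {..<L} z - g z" for z
  have "intpoly g" unfolding g_def by (intro intpoly_sum intpoly_mult intpoly_ev)
  then have "intpoly h" unfolding h_def by (intro intpoly_diff intpoly_mult intpoly_ev) auto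
  moreover have "ev S z ^ 2 = of_nat p * h z" if z: "z ^ L = 1" for z
  proof -
    have J: "ev S z * ev {..<L} z = of_nat p * of_nat c * ev {..<L} z"
      using z cardS by (simp add: ev_lessThan_root_of_unity)
    have "ev S z ^ 2 = ev S z * ev {..<L} z - ev R z * ev S z"
      unfolding SR[of z, symmetric] by (simp add: power2_eq_square algebra_simps)
    also have "\<dots> = of_nat p * h z"
      unfolding J RS[OF z] h_def by (simp add: algebra_simps)
    finally show ?thesis .
  qed
  ultimately have "S = {}"
    using p PL L_pos \<open>S \<subseteq> _\<close> by (intro ev_square_dvd_prime[of p L]) auto
  moreover have "RA u W \<subseteq> S"
  proof -
    have "RA u W = RA (u mod (p * m)) W" by (simp add: rigid_def)
    moreover have "u mod (p * m) < p * m" using p_gt_1 m_pos by simp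
    ultimately show ?thesis unfolding S_def by (metis UN_upper lessThan_iff)
  qed
  ultimately show ?thesis by simp
qed

text \<open>If no class freezes \<open>A\<close>, every class freezes \<open>B\<close>; this is the
  hypothesis \<open>uniform\<close> of \<open>slab_tiling\<close>.\<close>

lemma uniform_of_empty:
  assumes "\<And>u W. RA u W = {}" and ab: "a \<in> A" "a' \<in> A" "b \<in> B" "b' \<in> B" and e: "[a + b = a' + b'] (mod m * L)"
  shows "[b = b'] (mod p * m)"
proof -
  have em: "[a' + b' = a + b] (mod m)" using cong_sym[OF e] by (rule cong_modulus_mult_nat)
  have eL: "[a' + b' = a + b] (mod L)" using cong_sym[OF e] by (rule cong_dvd_modulus_nat) simp
  obtain x where x: "(a + b) mod L \<in> RB x (a + b)"
    using RA_RB_cover[of "(a + b) mod L" "a + b"] L_pos assms(1) by auto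
  then have "[b = x] (mod p * m)" "[b' = x] (mod p * m)"
    using ab em eL by (auto simp: rigid_def add.commute)
  then show ?thesis using cong_trans cong_sym by blast
qed

text \<open>By \<open>full_full\<close>, for small \<open>L\<close> one side has an empty set among
  the lifts of every residue. Then either all sets on that side are empty, or
  \<open>not_full_imp_empty\<close> empties the other side.\<close>

lemma RA_or_RB_empty:
  assumes "L < p ^ 2"
  shows "(\<forall>u W. RA u W = {}) \<or> (\<forall>x W. RB x W = {})"
proof -
  interpret sw: split_tiling p m L B A by (rule swap)
  have "(\<forall>x W. \<exists>x'. [x' = x] (mod m) \<and> RB x' W = {}) \<or> (\<forall>u W. \<exists>u'. [u' = u] (mod m) \<and> RA u' W = {})"
    using full_full assms by (meson not_le)
  then show ?thesis using not_full_imp_empty sw.not_full_imp_empty by meson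
qed

end

subsection \<open>Radicals and cyclotomic divisibility\<close>

lemma prod_pairwise_coprime_dvd:
  fixes f :: "'a \<Rightarrow> nat"
  assumes "finite S" "\<And>s. s \<in> S \<Longrightarrow> f s dvd N"
    and "\<And>s t. s \<in> S \<Longrightarrow> t \<in> S \<Longrightarrow> s \<noteq> t \<Longrightarrow> coprime (f s) (f t)"
  shows "(\<Prod>s\<in>S. f s) dvd N"
  using assms
proof (induction S rule: finite_induct)
  case (insert s S)
  have "coprime (f s) (\<Prod>t\<in>S. f t)"
    using insert by (intro prod_coprime_right) auto
  then show ?case using insert by (simp add: divides_mult)
qed simp

lemma D_mult_radical:
  assumes "0 < N"
  shows "D N * (\<Prod>q\<in>prime_factors N. q) = N"
proof -
  have "(\<Prod>q\<in>prime_factors N. q) dvd N"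
    by (rule prod_pairwise_coprime_dvd) (auto simp: in_prime_factors_iff primes_coprime)
  then show ?thesis by (simp add: D_def)
qed

lemma D_mono_dvd:
  assumes "L dvd N" "0 < N"
  shows "D L \<le> D N"
proof -
  obtain K where K: "N = L * K" using assms by blast
  then have pos: "0 < L" "0 < K" using assms by auto
  define F where "F = prime_factors N - prime_factors L"
  have N: "prime_factors N = prime_factors L \<union> F"
    using K pos by (auto simp: F_def in_prime_factors_iff)
  have "(\<Prod>q\<in>F. q) dvd K"
  proof (rule prod_pairwise_coprime_dvd)
    fix q assume "q \<in> F"
    then show "q dvd K" using K pos by (auto simp: F_def in_prime_factors_iff prime_dvd_mult_iff)
  qed (auto simp: F_def in_prime_factors_iff primes_coprime)
  then obtain K' where K': "K = (\<Prod>q\<in>F. q) * K'" by blast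
  have rad: "(\<Prod>q\<in>prime_factors N. q) = (\<Prod>q\<in>prime_factors L. q) * (\<Prod>q\<in>F. q)"
    unfolding N by (rule prod.union_disjoint) (auto simp: F_def)
  have radN: "0 < (\<Prod>q\<in>prime_factors N. q)"
    by (intro prod_pos) (auto simp: in_prime_factors_iff prime_gt_0_nat)
  have "D N * (\<Prod>q\<in>prime_factors N. q) = D L * (\<Prod>q\<in>prime_factors L. q) * K"
    using D_mult_radical[OF assms(2)] D_mult_radical[OF pos(1)] K by simp
  also have "\<dots> = (D L * K') * (\<Prod>q\<in>prime_factors N. q)" unfolding rad by (subst K') (simp only: mult_ac)
  finally have "D N = D L * K'" using radN by simp
  moreover have "0 < K'" using pos K' by (cases K') auto
  ultimately show ?thesis by simp
qed

text \<open>The square of the radical divides \<open>L\<close>, so the radical divides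
  \<open>D L\<close>, and \<open>L\<close> is the product of the two.\<close>

lemma powerful_le_D_square:
  assumes "0 < L" "\<And>q. prime q \<Longrightarrow> q dvd L \<Longrightarrow> q ^ 2 dvd L"
  shows "L \<le> D L ^ 2"
proof -
  let ?r = "\<Prod>q\<in>prime_factors L. q"
  have "(\<Prod>q\<in>prime_factors L. q ^ 2) dvd L"
    using assms by (intro prod_pairwise_coprime_dvd) (auto simp: in_prime_factors_iff primes_coprime)
  then have "?r * ?r dvd D L * ?r"
    using D_mult_radical[OF assms(1)] by (simp add: prod_power_distrib power2_eq_square prod.distrib)
  moreover have r: "0 < ?r" by (intro prod_pos) (auto simp: in_prime_factors_iff prime_gt_0_nat)
  ultimately have "?r dvd D L" by simp
  moreover have "0 < D L" using D_mult_radical[OF assms(1)] assms(1) by (cases "D L") auto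
  ultimately have "?r \<le> D L" by (rule dvd_imp_le)
  then have "D L * ?r \<le> D L * D L" by (rule mult_le_mono2)
  then show ?thesis using D_mult_radical[OF assms(1)] by (simp add: power2_eq_square)
qed

section \<open>Cyclotomic divisibility as vanishing at primitive roots\<close>

lemma prod_linear_factors_dvd_iff:
  fixes f :: "complex poly"
  assumes "finite K" "inj_on c K"
  shows "(\<Prod>k\<in>K. [:- c k, 1:]) dvd f \<longleftrightarrow> (\<forall>k\<in>K. poly f (c k) = 0)"
proof
  assume d: "(\<Prod>k\<in>K. [:- c k, 1:]) dvd f"
  show "\<forall>k\<in>K. poly f (c k) = 0"
  proof
    fix k assume "k \<in> K"
    then have "[:- c k, 1:] dvd (\<Prod>k\<in>K. [:- c k, 1:])" using assms by (intro dvd_prodI) auto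
    then have "[:- c k, 1:] dvd f" using d by (rule dvd_trans)
    then show "poly f (c k) = 0" by (simp add: poly_eq_0_iff_dvd)
  qed
next
  assume "\<forall>k\<in>K. poly f (c k) = 0"
  with assms show "(\<Prod>k\<in>K. [:- c k, 1:]) dvd f"
  proof (induction K rule: finite_induct)
    case (insert k K)
    then obtain g where g: "f = (\<Prod>k\<in>K. [:- c k, 1:]) * g" by (auto elim!: dvdE)
    have "poly (\<Prod>k\<in>K. [:- c k, 1:]) (c k) \<noteq> 0"
      using insert by (auto simp: poly_prod)
    then have "poly g (c k) = 0" using insert.prems(2) by (simp add: g)
    then have "[:- c k, 1:] dvd g" by (simp add: poly_eq_0_iff_dvd)
    then have "(\<Prod>k\<in>K. [:- c k, 1:]) * [:- c k, 1:] dvd f" unfolding g by (rule mult_dvd_mono[OF dvd_refl])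
    then show ?case using insert by (simp add: mult.commute)
  qed simp
qed

lemma cyclotomic_dvd_mask_iff:
  assumes "0 < s"
  shows "cyclotomic s dvd mask A \<longleftrightarrow> vanish s A"
proof -
  let ?K = "{k. k < s \<and> coprime k s}" and ?c = "\<lambda>k. cis (2 * pi * real k / real s)"
  have b: "bij_betw ?c {..<s} {z. z ^ s = 1}" by (rule Complex.bij_betw_roots_unity[OF assms])
  have inj: "inj_on ?c ?K" using b by (auto simp: bij_betw_def intro: inj_on_subset)
  have roots: "?c ` ?K = {z. primroot s z}"
  proof (intro equalityI subsetI)
    fix z assume "z \<in> {z. primroot s z}"
    then have z: "primroot s z" by simp
    have w: "primroot s (?c 1)" using assms by (intro primroot_cis) auto
    obtain r where r: "r < s" "z = ?c 1 ^ r"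
      using root_of_unity_power_primroot[OF w, of z] z by (auto simp: primroot_def)
    then have "coprime r s" using primroot_power[OF w] z by simp
    moreover have "z = ?c r" using r(2) by (simp add: Complex.DeMoivre mult.commute)
    ultimately show "z \<in> ?c ` ?K" using r by blast
  qed (use assms primroot_cis in auto)
  have "poly (mask A) z = ev A z" for z by (simp add: mask_def ev_def poly_sum poly_monom)
  then have "cyclotomic s dvd mask A \<longleftrightarrow> (\<forall>k\<in>?K. ev A (?c k) = 0)"
    unfolding cyclotomic_def using prod_linear_factors_dvd_iff[OF _ inj, of "mask A"] by simp
  also have "\<dots> \<longleftrightarrow> (\<forall>z\<in>?c ` ?K. ev A z = 0)" by blast
  finally show ?thesis unfolding roots vanish_def by simp
qed

section \<open>Passage between \<open>tiling\<close> with \<open>T2\<close> and \<open>tiles\<close>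
  with \<open>T2_mod\<close>\<close>

lemma tiling_imp_tiles:
  assumes "tiling N A B" "0 < N"
  shows "tiles N A B"
  unfolding tiles_def
proof (intro conjI ballI impI allI)
  have sub: "A \<subseteq> {..<N}" "B \<subseteq> {..<N}"
    and ex1: "x < N \<Longrightarrow> \<exists>!ab. fst ab \<in> A \<and> snd ab \<in> B \<and> (fst ab + snd ab) mod N = x" for x
    using assms by (auto simp: tiling_def)
  show "0 < N" "finite A" "finite B" using assms sub finite_subset by blast+
  {
    fix a a' b b' assume "a \<in> A" "a' \<in> A" "b \<in> B" "b' \<in> B" "[a + b = a' + b'] (mod N)"
    moreover have "(a + b) mod N < N" using assms by simp
    ultimately have "(a, b) = (a', b')"
      using ex1[of "(a + b) mod N"] unfolding cong_def by (metis fst_conv snd_conv)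
    then show "a = a'" "b = b'" by auto
  }
  fix y
  have "y mod N < N" using assms by simp
  then obtain ab where "fst ab \<in> A" "snd ab \<in> B" "(fst ab + snd ab) mod N = y mod N"
    using ex1 by blast
  then show "\<exists>a\<in>A. \<exists>b\<in>B. [a + b = y] (mod N)" by (auto simp: cong_def)
qed

lemma tiles_mod_inj:
  assumes "tiles N A B"
  shows "inj_on (\<lambda>a. a mod N) A"
proof (rule inj_onI)
  fix a a' assume a: "a \<in> A" "a' \<in> A" "a mod N = a' mod N"
  obtain b where "b \<in> B" using tiles_surj[OF assms] by blast
  moreover have "[a + b = a' + b] (mod N)"
    using a by (simp only: cong_add_rcancel_nat) (simp add: cong_def)
  ultimately show "a = a'" using tiles_inj[OF assms] a by blast
qed

lemma tiles_imp_tiling: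
  assumes t: "tiles N A B"
  shows "tiling N ((\<lambda>a. a mod N) ` A) ((\<lambda>b. b mod N) ` B)"
  unfolding tiling_def
proof (intro conjI allI impI)
  have N: "0 < N" using t by (simp add: tiles_def)
  then show "(\<lambda>a. a mod N) ` A \<subseteq> {..<N}" "(\<lambda>b. b mod N) ` B \<subseteq> {..<N}" by auto
  fix x assume x: "x < N"
  obtain a b where ab: "a \<in> A" "b \<in> B" "[a + b = x] (mod N)" using tiles_surj[OF t] .
  show "\<exists>!ab. fst ab \<in> (\<lambda>a. a mod N) ` A \<and> snd ab \<in> (\<lambda>b. b mod N) ` B \<and> (fst ab + snd ab) mod N = x"
  proof (rule ex1I[of _ "(a mod N, b mod N)"])
    show "fst (a mod N, b mod N) \<in> (\<lambda>a. a mod N) ` A \<and> snd (a mod N, b mod N) \<in> (\<lambda>b. b mod N) ` B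
        \<and> (fst (a mod N, b mod N) + snd (a mod N, b mod N)) mod N = x"
      using ab x by (simp add: cong_def mod_add_eq)
  next
    fix cd assume cd: "fst cd \<in> (\<lambda>a. a mod N) ` A \<and> snd cd \<in> (\<lambda>b. b mod N) ` B \<and> (fst cd + snd cd) mod N = x"
    then obtain a' b' where ab': "a' \<in> A" "b' \<in> B" "cd = (a' mod N, b' mod N)" by (cases cd) auto
    then have "[a + b = a' + b'] (mod N)" using cd ab x by (simp add: cong_def mod_add_eq)
    then have "a = a' \<and> b = b'" using tiles_inj[OF t] ab ab' by blast
    then show "cd = (a mod N, b mod N)" using ab' by simp
  qed
qed

lemma vanish_mod:
  assumes "inj_on (\<lambda>a. a mod N) A" "s dvd N"
  shows "vanish s ((\<lambda>a. a mod N) ` A) \<longleftrightarrow> vanish s A"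
proof -
  have "ev ((\<lambda>a. a mod N) ` A) z = ev A z" if "primroot s z" for z
  proof -
    have "z ^ N = 1" using that assms(2) by (simp add: primroot_def)
    then show ?thesis unfolding ev_def sum.reindex[OF assms(1)]
      by (intro sum.cong) (auto intro!: power_cong_root_of_unity simp: cong_def)
  qed
  then show ?thesis by (simp add: vanish_def)
qed

lemma T2_imp_T2_mod:
  assumes "T2 A"
  shows "T2_mod N A"
  unfolding T2_mod_def
proof (intro allI impI)
  fix s assume s: "1 < s" and v: "\<forall>q\<in>prime_factors s. vanish (q ^ multiplicity q s) A"
  \<comment> \<open>The maximal prime powers of \<open>s\<close> belong to distinct primes and
    multiply to \<open>s\<close>, so they form an admissible set in \<open>T2\<close>.\<close>
  let ?f = "\<lambda>q. q ^ multiplicity q s"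
  let ?S = "?f ` prime_factors s"
  have mult: "1 \<le> multiplicity q s" if "q \<in> prime_factors s" for q
    using that s by (intro multiplicity_pos) (auto simp: in_prime_factors_iff)
  have only: "l = q" if "prime l" "l dvd ?f q" "q \<in> prime_factors s" for l q
    using that by (metis in_prime_factors_iff prime_dvd_power primes_dvd_imp_eq)
  have inj: "inj_on ?f (prime_factors s)"
  proof (rule inj_onI)
    fix q l assume ql: "q \<in> prime_factors s" "l \<in> prime_factors s" "?f q = ?f l"
    have "q dvd ?f q" using mult[OF ql(1)] by (intro dvd_power) auto
    then show "q = l" using only[of q l] ql by (auto simp: in_prime_factors_iff)
  qed
  have "\<Prod>?S = (\<Prod>q\<in>prime_factors s. ?f q)" using prod.reindex[OF inj, of "\<lambda>x. x"] by simp
  then have prod: "\<Prod>?S = s" using s by (simp add: prod_prime_factors)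
  have "cyclotomic (\<Prod>?S) dvd mask A"
  proof (rule assms[unfolded T2_def, rule_format], intro conjI)
    show "finite ?S" by simp
    obtain q where "prime q" "q dvd s" using prime_factor_nat[of s] s by auto
    then have "q \<in> prime_factors s" using s by (simp add: in_prime_factors_iff)
    then show "?S \<noteq> {}" by blast
    show "?S \<subseteq> SA A"
    proof
      fix t assume "t \<in> ?S"
      then obtain q where q: "q \<in> prime_factors s" "t = ?f q" by blast
      then have "0 < t" by (auto simp: in_prime_factors_iff prime_gt_0_nat)
      then have "cyclotomic t dvd mask A" using v q cyclotomic_dvd_mask_iff by blast
      then show "t \<in> SA A" unfolding SA_def using q mult by (auto simp: in_prime_factors_iff)
    qed
    show "\<forall>t\<in>?S. \<forall>u\<in>?S. \<forall>p q. prime p \<and> prime q \<and> p dvd t \<and> q dvd u \<and> t \<noteq> u \<longrightarrow> p \<noteq> q"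
      using only by blast
  qed
  then show "vanish s A" using prod s cyclotomic_dvd_mask_iff[of s A] by simp
qed

text \<open>A tile vanishes only at prime powers dividing \<open>N\<close>, so
  \<open>\<Prod>S\<close> divides \<open>N\<close>, and the members of \<open>S\<close> are its
  maximal prime powers.\<close>

lemma T2_mod_imp_T2:
  assumes t: "tiles N A B" and T: "T2_mod N A"
  shows "T2 A"
  unfolding T2_def
proof (intro allI impI, elim conjE)
  fix S assume fin: "finite S" and ne: "S \<noteq> {}" and SA: "S \<subseteq> SA A"
    and dist: "\<forall>s\<in>S. \<forall>t\<in>S. \<forall>p q. prime p \<and> prime q \<and> p dvd s \<and> q dvd t \<and> s \<noteq> t \<longrightarrow> p \<noteq> q"
  have S: "\<exists>q i. prime q \<and> 1 \<le> i \<and> s = q ^ i \<and> vanish s A \<and> 1 < s" if s: "s \<in> S" for s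
  proof -
    obtain q i where q: "prime q" "1 \<le> i" "s = q ^ i" "cyclotomic s dvd mask A"
      using SA s unfolding SA_def by blast
    moreover have "1 < s" unfolding q(3) using q prime_gt_1_nat by (intro one_less_power) auto
    moreover from this have "vanish s A" using cyclotomic_dvd_mask_iff[of s A] q(4) by simp
    ultimately show ?thesis by blast
  qed
  have dvdN: "s dvd N" if "s \<in> S" for s
    using S[OF that] tiles_vanish_prime_power(1)[OF t] by blast
  have cop: "coprime s u" if su: "s \<in> S" "u \<in> S" "s \<noteq> u" for s u
  proof -
    have "\<not> (prime q \<and> q dvd gcd s u)" for q
      using dist[rule_format, OF su(1,2), of q q] su(3) by auto
    then have "gcd s u = 1" using prime_factor_nat[of "gcd s u"] by blast
    then show ?thesis by (simp add: coprime_iff_gcd_eq_1)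
  qed
  have "\<Prod>S dvd N" using prod_pairwise_coprime_dvd[of S "\<lambda>s. s" N] fin dvdN cop by simp
  moreover have pos: "0 < s" if "s \<in> S" for s using S[OF that] by (auto simp: prime_gt_0_nat)
  then have S0: "0 < \<Prod>S" by (intro prod_pos) auto
  have S1: "1 < \<Prod>S"
  proof -
    obtain s where s: "s \<in> S" using ne by blast
    then have "s dvd \<Prod>S" using fin dvd_prodI[of S s "\<lambda>s. s"] by simp
    then have "s \<le> \<Prod>S" using S0 by (rule dvd_imp_le)
    then show ?thesis using S[OF s] by auto
  qed
  moreover have "vanish (q ^ multiplicity q (\<Prod>S)) A" if q: "prime q" "q dvd \<Prod>S" for q
  proof -
    obtain s where s: "s \<in> S" "q dvd s" using q fin by (auto simp: prime_dvd_prod_iff)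
    obtain l i where l: "prime l" "s = l ^ i" "vanish s A" using S[OF s(1)] by blast
    have "l = q" using s l q by (metis prime_dvd_power primes_dvd_imp_eq)
    have "multiplicity q u = 0" if "u \<in> S - {s}" for u
      using dist s that q by (intro not_dvd_imp_multiplicity_0) blast
    then have "multiplicity q (\<Prod>(S - {s})) = 0"
      using q pos fin by (subst prime_elem_multiplicity_prod_distrib) auto
    moreover have "\<Prod>S = s * \<Prod>(S - {s})" using fin s by (simp add: prod.remove)
    moreover have "0 < \<Prod>(S - {s})" using pos by (intro prod_pos) auto
    ultimately have "multiplicity q (\<Prod>S) = multiplicity q s"
      using q pos[OF s(1)] by (simp add: prime_elem_multiplicity_mult_distrib)
    also have "\<dots> = i" using l \<open>l = q\<close> q by simp
    finally show ?thesis using l \<open>l = q\<close> by simp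
  qed
  ultimately have "vanish (\<Prod>S) A" by (rule T2_modD[OF T])
  then show "cyclotomic (\<Prod>S) dvd mask A" using S0 cyclotomic_dvd_mask_iff by blast
qed

section \<open>Induction on the modulus\<close>

lemma T2_mod_prime_power_mult:
  assumes p: "prime p" "\<not> p dvd M" and D: "D M < p"
    and base: "\<And>L A B. L dvd M \<Longrightarrow> tiles L A B \<Longrightarrow> T2_mod L A \<and> T2_mod L B"
    and L: "L dvd M" and t: "tiles (p ^ n * L) A B"
  shows "T2_mod (p ^ n * L) A \<and> T2_mod (p ^ n * L) B"
  using L t
\<comment> \<open>All divisors \<open>L\<close> of \<open>M\<close> are treated at once, since
  removing a prime can lower either \<open>n\<close> or \<open>L\<close>.\<close>
proof (induction "p ^ n * L" arbitrary: n L A B rule: less_induct)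
  case less
  note L = less.prems(1) and t = less.prems(2)
  have M: "0 < M" using p by (cases M) auto
  have p0: "0 < p" using p prime_gt_0_nat by blast
  have L0: "0 < L" using L M by (auto intro: Nat.gr0I)
  have pL: "coprime p L" using p L by (meson dvd_trans prime_imp_coprime)
  show ?case
  proof (cases n)
    case 0
    then show ?thesis using base[OF L] t by simp
  next
    case (Suc k)
    have N: "p ^ n * L = p * p ^ k * L" by (simp add: Suc)
    have reduce: "T2_mod (p ^ n * L) X \<and> T2_mod (p ^ n * L) Y"
      if tXY: "tiles (p ^ n * L) X Y" and q: "prime q" "q dvd p ^ n * L" "\<not> q dvd card X" for X Y q
    proof (rule T2_mod_reduce_prime[OF tXY q])
      fix X' Y' assume t': "tiles (p ^ n * L div q) X' Y'"
      have less_N: "p ^ n * L div q < p ^ n * L"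
        using q p0 L0 prime_gt_1_nat by (intro div_less_dividend) auto
      show "T2_mod (p ^ n * L div q) X' \<and> T2_mod (p ^ n * L div q) Y'"
      proof (cases "q = p")
        case True
        then have "p ^ n * L div q = p ^ k * L" using p0 by (simp add: Suc mult.assoc)
        then show ?thesis using less.hyps[of k L X' Y'] less_N L t' by simp
      next
        case False
        then have "q dvd L"
          using q p by (metis prime_dvd_mult_iff prime_dvd_power primes_dvd_imp_eq)
        then have "p ^ n * L div q = p ^ n * (L div q)" "L div q dvd L"
          by (auto simp: div_mult_swap elim!: dvdE)
        moreover from this have "L div q dvd M" using dvd_trans[OF _ L] by blast
        ultimately show ?thesis using less.hyps[of n "L div q" X' Y'] less_N t' by simp
      qed
    qed
    show ?thesis
    proof (cases "\<exists>q. prime q \<and> q dvd p ^ n * L \<and> (\<not> q dvd card A \<or> \<not> q dvd card B)")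
      case True
      then show ?thesis using reduce[OF t] reduce[OF tiles_sym[OF t]] by blast
    next
      case False
      \<comment> \<open>Here every prime of the modulus divides both cardinalities, so its square
        divides the modulus; for \<open>q\<close> coprime to \<open>p\<close> the square divides
        \<open>L\<close>.\<close>
      have "q ^ 2 dvd L" if q: "prime q" "q dvd L" for q
      proof -
        have "q dvd card A" "q dvd card B" using False q by auto
        then have "q ^ 2 dvd p ^ n * L"
          unfolding tiles_card[OF t, symmetric] power2_eq_square by (rule mult_dvd_mono)
        moreover have "coprime q p" using q pL p by (metis coprime_absorb_left coprime_commute
              coprime_divisors dvd_refl)
        then have "coprime (q ^ 2) (p ^ n)" by simp
        ultimately show ?thesis by (simp only: coprime_dvd_mult_right_iff)
      qed
      then have "L \<le> D L ^ 2" using L0 by (intro powerful_le_D_square)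
      also have "\<dots> < p ^ 2"
        using D_mono_dvd[OF L M] D by (intro power_strict_mono) auto
      finally have small: "L < p ^ 2" .
      have IH: "T2_mod (p ^ k * L) X \<and> T2_mod (p ^ k * L) Y" if "tiles (p ^ k * L) X Y" for X Y
      proof (rule less.hyps[OF _ L that])
        have "1 * (p ^ k * L) < p * (p ^ k * L)"
          using prime_gt_1_nat[OF p(1)] p0 L0 by (intro mult_strict_right_mono) auto
        then show "p ^ k * L < p ^ n * L" by (simp add: Suc mult.assoc)
      qed
      have t': "tiles (p * p ^ k * L) A B" using t unfolding N .
      interpret split_tiling p "p ^ k" L A B
      proof
        show "coprime (p * p ^ k) L" using pL by simp
        show "[a = a'] (mod p * p ^ k) \<or> [b = b'] (mod p * p ^ k)"
          if "a \<in> A" "a' \<in> A" "b \<in> B" "b' \<in> B" "[a + b = a' + b'] (mod p ^ k * L)" for a a' b b'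
          using tiles_split[of p k L A B a a' b b'] t' p(1) pL that by simp
      qed (use p t' in auto)
      interpret sw: split_tiling p "p ^ k" L B A by (rule swap)
      \<comment> \<open>With \<open>RA\<close> always empty, the \<open>B\<close>-component is
        always frozen and \<open>A\<close> is the tile to thin out; otherwise the roles are
        exchanged.\<close>
      from RA_or_RB_empty[OF small] show ?thesis
      proof
        assume e: "\<forall>u W. RA u W = {}"
        interpret slab_tiling p k L "p ^ k" A B
          using p(1) pL t' uniform_of_empty e by unfold_locales auto
        show ?thesis unfolding N using T2_mod_lift IH by blast
      next
        assume e: "\<forall>x W. RB x W = {}"
        interpret slab_tiling p k L "p ^ k" B A
          using p(1) pL tiles_sym[OF t'] sw.uniform_of_empty e by unfold_locales auto
        show ?thesis unfolding N using T2_mod_lift IH by blast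
      qed
    qed
  qed
qed

theorem theorem1p2:
  fixes p1 n1 M1 M :: nat
  assumes "prime p1"
    and "\<not> p1 dvd M1"
    and "M = p1 ^ n1 * M1"
    and "\<And>M' A' B'. M' dvd M1 \<Longrightarrow> tiling M' A' B' \<Longrightarrow> T2 A' \<and> T2 B'"
    and "p1 > D M1"
  shows "\<forall>A B. tiling M A B \<longrightarrow> T2 A \<and> T2 B"
proof (intro allI impI)
  fix A B assume tiling: "tiling M A B"
  have M1: "0 < M1" using assms(2) by (cases M1) auto
  then have "0 < M" using assms(1,3) prime_gt_0_nat by simp
  then have t: "tiles M A B" using tiling by (rule tiling_imp_tiles[rotated])
  \<comment> \<open>The hypothesis concerns subsets of \<open>{..<L}\<close>, so the tiles are
    reduced modulo \<open>L\<close>; this does not affect vanishing at orders dividing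
    \<open>L\<close>.\<close>
  have base: "T2_mod L X \<and> T2_mod L Y" if L: "L dvd M1" and tXY: "tiles L X Y" for L X Y
  proof -
    have "T2 ((\<lambda>a. a mod L) ` X)" "T2 ((\<lambda>b. b mod L) ` Y)"
      using assms(4)[OF L tiles_imp_tiling[OF tXY]] by auto
    then have "T2_mod L ((\<lambda>a. a mod L) ` X)" "T2_mod L ((\<lambda>b. b mod L) ` Y)"
      by (auto intro: T2_imp_T2_mod)
    moreover have "T2_mod L ((\<lambda>a. a mod L) ` Z) \<Longrightarrow> T2_mod L Z" if "inj_on (\<lambda>a. a mod L) Z" for Z
      unfolding T2_mod_def using vanish_mod[OF that] multiplicity_dvd dvd_trans by metis
    ultimately show ?thesis
      using tiles_mod_inj[OF tXY] tiles_mod_inj[OF tiles_sym[OF tXY]] by blast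
  qed
  have "T2_mod M A \<and> T2_mod M B"
    using T2_mod_prime_power_mult[OF assms(1,2,5) base dvd_refl] t unfolding assms(3) by blast
  then show "T2 A \<and> T2 B"
    using T2_mod_imp_T2[OF t] T2_mod_imp_T2[OF tiles_sym[OF t]] by blast
qed

end
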